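(* If $\mathfrak{g}$ is a real finite-dimensional, non-abelian reductive Lie algebra, then $\mathfrak{g}^*$, equipped with the Kirillov-Kostant-Souriau (KKS) Poisson structure, is not desingularizable.
   Context: Manifolds are smooth, connected and without boundary. A Lie algebroid over $M$ is a smooth vector bundle $\mathcal{A}\to M$ with a Lie bracket on $\Gamma(\mathcal{A})$ and a bundle map $\rho:\mathcal{A}\to TM$ (the anchor) satisfying the Leibniz rule. It is almost-injective if $\rho_x$ is injective for all $x$ in some open dense subset of $M$. A symplectic Lie algebroid $(\mathcal{A},\rho,\pi_{\mathcal{A}})$ is a Lie algebroid with a nondegenerate section $\pi_{\mathcal{A}}\in\Gamma(\bigwedge^2\mathcal{A})$ (i.e. $\pi_{\mathcal{A}}^\sharp:\mathcal{A}^*\to\mathcal{A}$ is an isomorphism) with $[\pi_{\mathcal{A}},\pi_{\mathcal{A}}]=0$ for the Schouten-Nijenhuis bracket. Rank $0$ is allowed. A Poisson manifold $(M,\pi)$ is desingularizable if there is a symplectic Lie algebroid $(\mathcal{A},\rho,\pi_{\mathcal{A}})$ over $M$ with almost-injective anchor such that $\pi=\wedge^2\rho(\pi_{\mathcal{A}})$. The KKS Poisson structure on $\mathfrak{g}^*$ is $\{f,g\}(\xi)=\langle\xi,[d_\xi f,d_\xi g]\rangle$ for $f,g\in C^\infty(\mathfrak{g}^* )$, $\xi\in\mathfrak{g}^*$, with $d_\xi f,d_\xi g\in(\mathfrak{g}^* )^*\cong\mathfrak{g}$. Reductive means $\mathfrak{g}=\mathfrak{s}\oplus\mathfrak{z}$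 as Lie algebras with $\mathfrak{s}$ semisimple and $\mathfrak{z}$ abelian. *)

theory Defs
  imports "HOL-Analysis.Analysis"
begin

section \<open>Real Lie algebras\<close>

definition lie_algebra :: "('g::real_vector \<Rightarrow> 'g \<Rightarrow> 'g) \<Rightarrow> bool" where
  "lie_algebra br \<longleftrightarrow>
     bilinear br \<and> (\<forall>x. br x x = 0) \<and>
     (\<forall>x y z. br x (br y z) + br y (br z x) + br z (br x y) = 0)"

definition lie_subalgebra :: "('g::real_vector \<Rightarrow> 'g \<Rightarrow> 'g) \<Rightarrow> 'g set \<Rightarrow> bool" where
  "lie_subalgebra br S \<longleftrightarrow> subspace S \<and> (\<forall>x\<in>S. \<forall>y\<in>S. br x y \<in> S)"

definition abelian_on :: "('g::real_vector \<Rightarrow> 'g \<Rightarrow> 'g) \<Rightarrow> 'g set \<Rightarrow> bool" where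
  "abelian_on br S \<longleftrightarrow> (\<forall>x\<in>S. \<forall>y\<in>S. br x y = 0)"

definition lie_ideal :: "('g::real_vector \<Rightarrow> 'g \<Rightarrow> 'g) \<Rightarrow> 'g set \<Rightarrow> 'g set \<Rightarrow> bool" where
  "lie_ideal br S I \<longleftrightarrow> subspace I \<and> I \<subseteq> S \<and> (\<forall>x\<in>S. \<forall>y\<in>I. br x y \<in> I)"

definition simple_on :: "('g::real_vector \<Rightarrow> 'g \<Rightarrow> 'g) \<Rightarrow> 'g set \<Rightarrow> bool" where
  "simple_on br S \<longleftrightarrow> lie_subalgebra br S \<and> \<not> abelian_on br S \<and>
     (\<forall>I. lie_ideal br S I \<longrightarrow> I = {0} \<or> I = S)"

text \<open>Semisimple means: a finite (possibly empty) direct sum of simple Lie algebras.  The sum is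
  internal: the vector space is the direct sum of the summands, and different summands commute.\<close>

definition semisimple_on :: "('g::real_vector \<Rightarrow> 'g \<Rightarrow> 'g) \<Rightarrow> 'g set \<Rightarrow> bool" where
  "semisimple_on br L \<longleftrightarrow> (\<exists>(n::nat) S.
     (\<forall>i<n. simple_on br (S i)) \<and>
     (\<forall>i<n. \<forall>j<n. i \<noteq> j \<longrightarrow> (\<forall>x\<in>S i. \<forall>y\<in>S j. br x y = 0)) \<and>
     bij_betw (\<lambda>c. \<Sum>i<n. c i) (Pi\<^sub>E {..<n} S) L)"

definition reductive :: "('g::real_vector \<Rightarrow> 'g \<Rightarrow> 'g) \<Rightarrow> bool" where
  "reductive br \<longleftrightarrow> (\<exists>s z.
     lie_subalgebra br s \<and> lie_subalgebra br z \<and>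
     (\<forall>x\<in>s. \<forall>y\<in>z. br x y = 0) \<and>
     bij_betw (\<lambda>(x, y). x + y) (s \<times> z) UNIV \<and>
     semisimple_on br s \<and> abelian_on br z)"


section \<open>Smooth functions on open subsets of a finite-dimensional vector space\<close>

text \<open>The domain is only required to be a normed space, because the dual of a Euclidean space, in the
  form of the type of bounded linear functionals, is not an instance of the class of Euclidean
  spaces.  In finite dimension the recursion through directional derivatives gives the usual
  classes of k times continuously differentiable functions on an open set.\<close>

fun Ck_on :: "nat \<Rightarrow> 'm::real_normed_vector set \<Rightarrow> ('m \<Rightarrow> 'b::real_normed_vector) \<Rightarrow> bool" where
  "Ck_on 0 U f \<longleftrightarrow> continuous_on U f"
| "Ck_on (Suc k) U f \<longleftrightarrow> (\<forall>x\<in>U. f differentiable (at x)) \<and>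
     (\<forall>v. Ck_on k U (\<lambda>x. frechet_derivative f (at x) v))"

definition smooth_on :: "'m::real_normed_vector set \<Rightarrow> ('m \<Rightarrow> 'b::real_normed_vector) \<Rightarrow> bool" where
  "smooth_on U f \<longleftrightarrow> (\<forall>k. Ck_on k U f)"


section \<open>Smooth vector bundles\<close>

definition linear_map_on :: "'a::real_vector set \<Rightarrow> ('a \<Rightarrow> 'b::real_vector) \<Rightarrow> bool" where
  "linear_map_on V f \<longleftrightarrow> (\<forall>a\<in>V. \<forall>b\<in>V. f (a + b) = f a + f b) \<and>
     (\<forall>c. \<forall>a\<in>V. f (c *\<^sub>R a) = c *\<^sub>R f a)"

text \<open>The model fibre of rank \<open>r\<close>; a type could not have dimension \<open>0\<close>.\<close>

definition coord_space :: "nat \<Rightarrow> (nat \<Rightarrow> real) set" where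
  "coord_space r = {v. \<forall>i\<ge>r. v i = 0}"

text \<open>The base manifold is the vector space \<open>'m\<close>, all of whose tangent spaces are \<open>'m\<close>.
  The fibre over \<open>x\<close> is a linear subspace \<open>fibre A x\<close> of a real vector space \<open>'a\<close>, and the total
  space is the disjoint union of the fibres.  This is no restriction as \<open>'a\<close> is arbitrary (it can be
  the direct sum of all the fibres); \<open>'a\<close> carries no topology, and the only smooth structure is the
  one given by the local trivializations: \<open>(U, \<phi>) \<in> trivs A\<close> stands for the trivialization
  \<open>(x, a) \<mapsto> (x, \<phi> x a)\<close> over \<open>U\<close>.\<close>

record ('m, 'a) lie_algebroid =
  fibre :: "'m \<Rightarrow> 'a set"
  rk :: nat
  trivs :: "('m set \<times> ('m \<Rightarrow> 'a \<Rightarrow> nat \<Rightarrow> real)) set"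
  bracket :: "('m \<Rightarrow> 'a) \<Rightarrow> ('m \<Rightarrow> 'a) \<Rightarrow> 'm \<Rightarrow> 'a"
  anchor :: "'m \<Rightarrow> 'a \<Rightarrow> 'm"

text \<open>The last clause says that the transition functions are smooth; they are linear in \<open>v\<close>, so it is
  enough to vary the base point.\<close>

definition smooth_vector_bundle ::
    "('m::real_normed_vector, 'a::real_vector) lie_algebroid \<Rightarrow> bool" where
  "smooth_vector_bundle A \<longleftrightarrow>
     (\<forall>x. subspace (fibre A x)) \<and>
     (\<forall>(U, \<phi>)\<in>trivs A. open U \<and>
        (\<forall>x\<in>U. (\<forall>i<rk A. linear_map_on (fibre A x) (\<lambda>a. \<phi> x a i)) \<and>
               bij_betw (\<phi> x) (fibre A x) (coord_space (rk A)))) \<and>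
     (\<Union>(U, \<phi>)\<in>trivs A. U) = UNIV \<and>
     (\<forall>(U, \<phi>)\<in>trivs A. \<forall>(W, \<psi>)\<in>trivs A. \<forall>v\<in>coord_space (rk A). \<forall>i<rk A.
        smooth_on (U \<inter> W) (\<lambda>x. \<psi> x (inv_into (fibre A x) (\<phi> x) v) i))"

definition smooth_section ::
    "('m::real_normed_vector, 'a::real_vector) lie_algebroid \<Rightarrow> ('m \<Rightarrow> 'a) \<Rightarrow> bool" where
  "smooth_section A s \<longleftrightarrow> (\<forall>x. s x \<in> fibre A x) \<and>
     (\<forall>(U, \<phi>)\<in>trivs A. \<forall>i<rk A. smooth_on U (\<lambda>x. \<phi> x (s x) i))"


section \<open>Lie algebroids\<close>

definition smooth_anchor ::
    "('m::real_normed_vector, 'a::real_vector) lie_algebroid \<Rightarrow> bool" where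
  "smooth_anchor A \<longleftrightarrow>
     (\<forall>x. linear_map_on (fibre A x) (anchor A x)) \<and>
     (\<forall>(U, \<phi>)\<in>trivs A. \<forall>v\<in>coord_space (rk A).
        smooth_on U (\<lambda>x. anchor A x (inv_into (fibre A x) (\<phi> x) v)))"

definition lie_algebroid ::
    "('m::real_normed_vector, 'a::real_vector) lie_algebroid \<Rightarrow> bool" where
  "lie_algebroid A \<longleftrightarrow>
     smooth_vector_bundle A \<and> smooth_anchor A \<and>
     (\<forall>s t. smooth_section A s \<longrightarrow> smooth_section A t \<longrightarrow> smooth_section A (bracket A s t)) \<and>
     (\<forall>s s' t. smooth_section A s \<longrightarrow> smooth_section A s' \<longrightarrow> smooth_section A t \<longrightarrow>
        bracket A (\<lambda>x. s x + s' x) t = (\<lambda>x. bracket A s t x + bracket A s' t x) \<and>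
        bracket A t (\<lambda>x. s x + s' x) = (\<lambda>x. bracket A t s x + bracket A t s' x)) \<and>
     (\<forall>c s t. smooth_section A s \<longrightarrow> smooth_section A t \<longrightarrow>
        bracket A (\<lambda>x. c *\<^sub>R s x) t = (\<lambda>x. c *\<^sub>R bracket A s t x) \<and>
        bracket A s (\<lambda>x. c *\<^sub>R t x) = (\<lambda>x. c *\<^sub>R bracket A s t x)) \<and>
     (\<forall>s. smooth_section A s \<longrightarrow> bracket A s s = (\<lambda>x. 0)) \<and>
     (\<forall>s t u. smooth_section A s \<longrightarrow> smooth_section A t \<longrightarrow> smooth_section A u \<longrightarrow>
        (\<forall>x. bracket A s (bracket A t u) x + bracket A t (bracket A u s) x
              + bracket A u (bracket A s t) x = 0)) \<and>
     (\<forall>s t (f :: 'm \<Rightarrow> real). smooth_section A s \<longrightarrow> smooth_section A t \<longrightarrow> smooth_on UNIV f \<longrightarrow>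
        (\<forall>x. bracket A s (\<lambda>y. f y *\<^sub>R t y) x =
              f x *\<^sub>R bracket A s t x + frechet_derivative f (at x) (anchor A x (s x)) *\<^sub>R t x))"

definition almost_injective ::
    "('m::real_normed_vector, 'a::real_vector) lie_algebroid \<Rightarrow> bool" where
  "almost_injective A \<longleftrightarrow>
     (\<exists>D. open D \<and> closure D = UNIV \<and> (\<forall>x\<in>D. inj_on (anchor A x) (fibre A x)))"


section \<open>Bivector sections and the Schouten-Nijenhuis bracket\<close>

text \<open>Linear functionals on a subspace are represented by their extension by \<open>0\<close>, so that equality of
  functions is equality of functionals.\<close>

definition extend0 :: "'a set \<Rightarrow> ('a \<Rightarrow> real) \<Rightarrow> 'a \<Rightarrow> real" where
  "extend0 V f = (\<lambda>a. if a \<in> V then f a else 0)"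

definition dual_space :: "'a::real_vector set \<Rightarrow> ('a \<Rightarrow> real) set" where
  "dual_space V = {\<alpha>. linear_map_on V \<alpha> \<and> (\<forall>a. a \<notin> V \<longrightarrow> \<alpha> a = 0)}"

text \<open>An element of the second (third) exterior power of a fibre is regarded as an alternating bilinear
  (trilinear) form on the dual of the fibre.\<close>

definition bivector_section ::
    "('m::real_normed_vector, 'a::real_vector) lie_algebroid
      \<Rightarrow> ('m \<Rightarrow> ('a \<Rightarrow> real) \<Rightarrow> ('a \<Rightarrow> real) \<Rightarrow> real) \<Rightarrow> bool" where
  "bivector_section A P \<longleftrightarrow>
     (\<forall>x. \<forall>\<alpha>\<in>dual_space (fibre A x). P x \<alpha> \<alpha> = 0 \<and>
        (\<forall>\<beta>\<in>dual_space (fibre A x). \<forall>\<gamma>\<in>dual_space (fibre A x). \<forall>c d.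
           P x (\<lambda>a. c * \<alpha> a + d * \<beta> a) \<gamma> = c * P x \<alpha> \<gamma> + d * P x \<beta> \<gamma> \<and>
           P x \<gamma> (\<lambda>a. c * \<alpha> a + d * \<beta> a) = c * P x \<gamma> \<alpha> + d * P x \<gamma> \<beta>)) \<and>
     (\<forall>(U, \<phi>)\<in>trivs A. \<forall>i<rk A. \<forall>j<rk A.
        smooth_on U (\<lambda>x. P x (extend0 (fibre A x) (\<lambda>a. \<phi> x a i))
                             (extend0 (fibre A x) (\<lambda>a. \<phi> x a j))))"

definition sharp ::
    "('m, 'a::real_vector) lie_algebroid
      \<Rightarrow> ('m \<Rightarrow> ('a \<Rightarrow> real) \<Rightarrow> ('a \<Rightarrow> real) \<Rightarrow> real) \<Rightarrow> 'm \<Rightarrow> ('a \<Rightarrow> real) \<Rightarrow> 'a" where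
  "sharp A P x \<alpha> =
     (THE a. a \<in> fibre A x \<and> (\<forall>\<beta>\<in>dual_space (fibre A x). \<beta> a = P x \<alpha> \<beta>))"

definition nondegenerate ::
    "('m, 'a::real_vector) lie_algebroid
      \<Rightarrow> ('m \<Rightarrow> ('a \<Rightarrow> real) \<Rightarrow> ('a \<Rightarrow> real) \<Rightarrow> real) \<Rightarrow> bool" where
  "nondegenerate A P \<longleftrightarrow>
     (\<forall>x. bij_betw (sharp A P x) (dual_space (fibre A x)) (fibre A x))"

definition wedge2 :: "'a \<Rightarrow> 'a \<Rightarrow> ('a \<Rightarrow> real) \<Rightarrow> ('a \<Rightarrow> real) \<Rightarrow> real" where
  "wedge2 a b \<alpha> \<beta> = \<alpha> a * \<beta> b - \<alpha> b * \<beta> a"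

definition wedge3 ::
    "'a \<Rightarrow> 'a \<Rightarrow> 'a \<Rightarrow> ('a \<Rightarrow> real) \<Rightarrow> ('a \<Rightarrow> real) \<Rightarrow> ('a \<Rightarrow> real) \<Rightarrow> real" where
  "wedge3 a b c \<alpha> \<beta> \<gamma> =
     \<alpha> a * wedge2 b c \<beta> \<gamma> - \<alpha> b * wedge2 a c \<beta> \<gamma> + \<alpha> c * wedge2 a b \<beta> \<gamma>"

text \<open>\<open>schouten_bracket A P Q T\<close> says that \<open>T\<close> is the Schouten-Nijenhuis bracket of the bivector
  sections \<open>P\<close> and \<open>Q\<close>, i.e. the value of the biadditive extension of
  \[ [X \wedge Y, Z \wedge W] = [X,Z] \wedge Y \wedge W - [X,W] \wedge Y \wedge Z
     - [Y,Z] \wedge X \wedge W + [Y,W] \wedge X \wedge Z. \]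
  Every bivector section is a finite sum of wedge products of global sections, and the Leibniz rule
  makes the value independent of the chosen decompositions.\<close>

definition schouten_bracket ::
    "('m::real_normed_vector, 'a::real_vector) lie_algebroid
      \<Rightarrow> ('m \<Rightarrow> ('a \<Rightarrow> real) \<Rightarrow> ('a \<Rightarrow> real) \<Rightarrow> real)
      \<Rightarrow> ('m \<Rightarrow> ('a \<Rightarrow> real) \<Rightarrow> ('a \<Rightarrow> real) \<Rightarrow> real)
      \<Rightarrow> ('m \<Rightarrow> ('a \<Rightarrow> real) \<Rightarrow> ('a \<Rightarrow> real) \<Rightarrow> ('a \<Rightarrow> real) \<Rightarrow> real) \<Rightarrow> bool" where
  "schouten_bracket A P Q T \<longleftrightarrow> (\<exists>(n::nat) X Y (m::nat) Z W.
     (\<forall>i<n. smooth_section A (X i) \<and> smooth_section A (Y i)) \<and>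
     (\<forall>j<m. smooth_section A (Z j) \<and> smooth_section A (W j)) \<and>
     (\<forall>x. \<forall>\<alpha>\<in>dual_space (fibre A x). \<forall>\<beta>\<in>dual_space (fibre A x).
        P x \<alpha> \<beta> = (\<Sum>i<n. wedge2 (X i x) (Y i x) \<alpha> \<beta>) \<and>
        Q x \<alpha> \<beta> = (\<Sum>j<m. wedge2 (Z j x) (W j x) \<alpha> \<beta>) \<and>
        (\<forall>\<gamma>\<in>dual_space (fibre A x).
          T x \<alpha> \<beta> \<gamma> = (\<Sum>i<n. \<Sum>j<m.
              wedge3 (bracket A (X i) (Z j) x) (Y i x) (W j x) \<alpha> \<beta> \<gamma>
            - wedge3 (bracket A (X i) (W j) x) (Y i x) (Z j x) \<alpha> \<beta> \<gamma>
            - wedge3 (bracket A (Y i) (Z j) x) (X i x) (W j x) \<alpha> \<beta> \<gamma>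
            + wedge3 (bracket A (Y i) (W j) x) (X i x) (Z j x) \<alpha> \<beta> \<gamma>))))"

definition symplectic_lie_algebroid ::
    "('m::real_normed_vector, 'a::real_vector) lie_algebroid
      \<Rightarrow> ('m \<Rightarrow> ('a \<Rightarrow> real) \<Rightarrow> ('a \<Rightarrow> real) \<Rightarrow> real) \<Rightarrow> bool" where
  "symplectic_lie_algebroid A P \<longleftrightarrow>
     lie_algebroid A \<and> bivector_section A P \<and> nondegenerate A P \<and>
     schouten_bracket A P P (\<lambda>x \<alpha> \<beta> \<gamma>. 0)"


section \<open>Desingularizable Poisson structures\<close>

definition anchor_push ::
    "('m, 'a) lie_algebroid \<Rightarrow> ('m \<Rightarrow> ('a \<Rightarrow> real) \<Rightarrow> ('a \<Rightarrow> real) \<Rightarrow> real)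
      \<Rightarrow> 'm \<Rightarrow> ('m \<Rightarrow> real) \<Rightarrow> ('m \<Rightarrow> real) \<Rightarrow> real" where
  "anchor_push A P x \<mu> \<nu> =
     P x (extend0 (fibre A x) (\<mu> \<circ> anchor A x)) (extend0 (fibre A x) (\<nu> \<circ> anchor A x))"

text \<open>A Poisson structure is given by its bracket \<open>pb\<close> on smooth functions; the corresponding bivector
  field is determined by its values \<open>pb f g x\<close> on pairs of differentials at \<open>x\<close>.  The first argument
  fixes the type in which the fibres of the algebroid live.\<close>

definition desingularizable ::
    "'a::real_vector itself \<Rightarrow>
     (('m::real_normed_vector \<Rightarrow> real) \<Rightarrow> ('m \<Rightarrow> real) \<Rightarrow> 'm \<Rightarrow> real) \<Rightarrow> bool" where
  "desingularizable (ty :: 'a itself) pb \<longleftrightarrow>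
     (\<exists>(A :: ('m, 'a) lie_algebroid) P.
        symplectic_lie_algebroid A P \<and> almost_injective A \<and>
        (\<forall>f g. smooth_on UNIV f \<longrightarrow> smooth_on UNIV g \<longrightarrow>
          (\<forall>x. pb f g x =
            anchor_push A P x (frechet_derivative f (at x)) (frechet_derivative g (at x)))))"


section \<open>The KKS Poisson structure on the dual of a Lie algebra\<close>

text \<open>The derivative at \<open>\<xi>\<close> of a function on the dual space, as an element of the double dual
  identified with the original space.\<close>

definition differential ::
    "(('g::euclidean_space \<Rightarrow>\<^sub>L real) \<Rightarrow> real) \<Rightarrow> ('g \<Rightarrow>\<^sub>L real) \<Rightarrow> 'g" where
  "differential f \<xi> =
     (THE x. \<forall>\<eta>. frechet_derivative f (at \<xi>) \<eta> = blinfun_apply \<eta> x)"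

definition kks_bracket ::
    "('g::euclidean_space \<Rightarrow> 'g \<Rightarrow> 'g) \<Rightarrow> (('g \<Rightarrow>\<^sub>L real) \<Rightarrow> real) \<Rightarrow> (('g \<Rightarrow>\<^sub>L real) \<Rightarrow> real)
      \<Rightarrow> ('g \<Rightarrow>\<^sub>L real) \<Rightarrow> real" where
  "kks_bracket br f g \<xi> = blinfun_apply \<xi> (br (differential f \<xi>) (differential g \<xi>))"

end

theory Submission imports Defs begin

text \<open>Suppose that an algebroid of rank \<open>r\<close> with anchor \<open>\<rho>\<close> and bivector \<open>\<pi>\<^sub>A\<close> desingularizes the
  linear Poisson structure \<open>\<pi>\<close> on the dual of \<open>g\<close>.  Let \<open>I\<close> be the annihilator in \<open>g\<close> of the image
  of \<open>\<rho>\<close> at the origin, and let \<open>d\<close> be the dimension of that image, so the codimension of \<open>I\<close>.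
  Comparing \<open>d\<close> with \<open>r\<close> at the origin and at a point where the anchor is injective gives a
  contradiction unless \<open>I = g\<close>.

  At the origin \<open>\<pi>\<close> vanishes.  Hence the Hamiltonian elements \<open>\<pi>\<^sub>A\<^sup>\<sharp>(\<rho>\<^sup>* y)\<close> of the fibre lie in the
  kernel of the anchor; as \<open>\<pi>\<^sub>A\<close> is nondegenerate, they form a space of dimension \<open>d\<close>.  Kernel and
  image together give \<open>2d \<le> r\<close> (lemma \<open>twice_dim_image_le\<close>).

  Next, \<open>I\<close> is an abelian ideal.  Write \<open>\<pi>\<^sub>A\<close> as a sum of products of global sections, so that \<open>\<pi>\<close> is
  the corresponding sum of products of vector fields.  Pairing with two elements of \<open>I\<close> gives a sum of
  products of functions vanishing at the origin; its derivative there is zero, but it is also their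
  Lie bracket, so \<open>I\<close> is abelian (lemma \<open>linear_bivector_derivative\<close>).  The anchor respects
  brackets (lemma \<open>anchor_bracket\<close>), so the vector fields in its image are closed under the Lie
  bracket; differentiating \<open>\<pi>\<close> in their directions shows that \<open>I\<close> is an ideal (lemma
  \<open>annihilator_invariant\<close>).

  In a reductive Lie algebra an abelian ideal is central (lemma
  \<open>abelian_ideal_of_reductive_central\<close>).  So each \<open>x\<close> in \<open>I\<close>, as a linear function, has vanishing
  Hamiltonian vector field.  Where \<open>\<rho>\<close> is injective this forces \<open>\<pi>\<^sub>A\<^sup>\<sharp>(\<rho>\<^sup>* x) = 0\<close> and then
  \<open>\<rho>\<^sup>* x = 0\<close>.  There the image of the anchor has dimension \<open>r\<close> and is annihilated by \<open>I\<close>, so \<open>r \<le> d\<close>.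
  Together, \<open>d = 0\<close> and \<open>g = I\<close> is abelian.\<close>

section \<open>Calculus of smooth functions\<close>

lemma frechet_derivative_cong_open:
  assumes "open U" "x \<in> U" "\<And>y. y \<in> U \<Longrightarrow> f y = g y" "f differentiable (at x)"
  shows "g differentiable (at x)" "frechet_derivative g (at x) = frechet_derivative f (at x)"
proof -
  have "(f has_derivative frechet_derivative f (at x)) (at x)"
    using assms(4) by (simp add: frechet_derivative_works)
  then have "(g has_derivative frechet_derivative f (at x)) (at x)"
    by (rule has_derivative_transform_within_open[OF _ assms(1,2)]) (use assms(3) in auto)
  then show "g differentiable (at x)" "frechet_derivative g (at x) = frechet_derivative f (at x)"
    using frechet_derivative_at[of g] by (auto simp: differentiable_def)
qed

lemma Ck_on_cong:
  assumes "open U" "\<And>y. y \<in> U \<Longrightarrow> f y = g y" "Ck_on k U f"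
  shows "Ck_on k U g"
  using assms
proof (induction k arbitrary: f g)
  case 0
  then show ?case by (auto cong: continuous_on_cong)
next
  case (Suc k)
  have *: "g differentiable (at x)" "frechet_derivative g (at x) = frechet_derivative f (at x)"
    if "x \<in> U" for x
    using frechet_derivative_cong_open[OF Suc.prems(1) that Suc.prems(2)] Suc.prems(3) that by auto
  have "Ck_on k U (\<lambda>x. frechet_derivative g (at x) v)" for v
    by (rule Suc.IH[OF Suc.prems(1), of "\<lambda>x. frechet_derivative f (at x) v"])
      (use * Suc.prems(3) in auto)
  then show ?case using * by simp
qed

lemma Ck_on_Suc_imp_Ck_on: "Ck_on (Suc k) U f \<Longrightarrow> Ck_on k U f"
proof (induction k arbitrary: f)
  case 0
  then show ?case
    by (auto intro!: continuous_at_imp_continuous_on differentiable_imp_continuous_within)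
next
  case (Suc k)
  then show ?case by (metis Ck_on.simps(2))
qed

lemma Ck_on_const: "Ck_on k U (\<lambda>x. c)"
proof (induction k arbitrary: c)
  case (Suc k)
  then show ?case by (simp add: frechet_derivative_const)
qed simp

lemma Ck_on_bounded_linear:
  assumes "bounded_linear f"
  shows "Ck_on k U f"
proof (cases k)
  case 0
  then show ?thesis using assms by (simp add: linear_continuous_on)
next
  case (Suc j)
  have "f differentiable (at x)" "frechet_derivative f (at x) = f" for x
    using bounded_linear_imp_has_derivative[OF assms, of "at x"]
    using frechet_derivative_at[of f] by (auto simp: differentiable_def)
  then show ?thesis using Suc by (simp add: Ck_on_const)
qed

lemma Ck_on_compose_bounded_linear:
  assumes "bounded_linear L" "open U" "Ck_on k U f"
  shows "Ck_on k U (\<lambda>x. L (f x))"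
  using assms(3)
proof (induction k arbitrary: f)
  case 0
  then show ?case using bounded_linear.continuous_on[OF assms(1)] by auto
next
  case (Suc k)
  have *: "((\<lambda>x. L (f x)) has_derivative (\<lambda>v. L (frechet_derivative f (at x) v))) (at x)"
    if "x \<in> U" for x
    using Suc.prems that
    by (intro bounded_linear.has_derivative[OF assms(1)]) (auto simp: frechet_derivative_works)
  have deriv: "frechet_derivative (\<lambda>x. L (f x)) (at x) v = L (frechet_derivative f (at x) v)"
    if "x \<in> U" for x v
    using that by (simp add: frechet_derivative_at[OF *, symmetric])
  have "Ck_on k U (\<lambda>x. frechet_derivative (\<lambda>x. L (f x)) (at x) v)" for v
  proof (rule Ck_on_cong[OF assms(2) sym])
    show "Ck_on k U (\<lambda>x. L (frechet_derivative f (at x) v))"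
      by (rule Suc.IH) (use Suc.prems in simp)
  qed (rule deriv)
  then show ?case using differentiableI[OF *] by simp
qed

lemma Ck_on_add:
  assumes "open U" "Ck_on k U f" "Ck_on k U g"
  shows "Ck_on k U (\<lambda>x. f x + g x)"
  using assms(2,3)
proof (induction k arbitrary: f g)
  case 0
  then show ?case by (auto intro: continuous_on_add)
next
  case (Suc k)
  have *: "((\<lambda>x. f x + g x) has_derivative
      (\<lambda>v. frechet_derivative f (at x) v + frechet_derivative g (at x) v)) (at x)"
    if "x \<in> U" for x
    using Suc.prems that by (intro has_derivative_add) (auto simp: frechet_derivative_works)
  have deriv: "frechet_derivative (\<lambda>x. f x + g x) (at x) v
      = frechet_derivative f (at x) v + frechet_derivative g (at x) v" if "x \<in> U" for x v
    using that by (simp add: frechet_derivative_at[OF *, symmetric])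
  have "Ck_on k U (\<lambda>x. frechet_derivative (\<lambda>x. f x + g x) (at x) v)" for v
  proof (rule Ck_on_cong[OF assms(1) sym])
    show "Ck_on k U (\<lambda>x. frechet_derivative f (at x) v + frechet_derivative g (at x) v)"
      by (rule Suc.IH) (use Suc.prems in simp_all)
  qed (rule deriv)
  then show ?case using differentiableI[OF *] by simp
qed

lemma Ck_on_mult:
  fixes f g :: "'m::real_normed_vector \<Rightarrow> real"
  assumes "open U" "Ck_on k U f" "Ck_on k U g"
  shows "Ck_on k U (\<lambda>x. f x * g x)"
  using assms(2,3)
proof (induction k arbitrary: f g)
  case 0
  then show ?case by (auto intro: continuous_on_mult)
next
  case (Suc k)
  have *: "((\<lambda>x. f x * g x) has_derivative
      (\<lambda>v. f x * frechet_derivative g (at x) v + frechet_derivative f (at x) v * g x)) (at x)"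
    if "x \<in> U" for x
    using Suc.prems that by (intro has_derivative_mult) (auto simp: frechet_derivative_works)
  have deriv: "frechet_derivative (\<lambda>x. f x * g x) (at x) v
      = f x * frechet_derivative g (at x) v + frechet_derivative f (at x) v * g x"
    if "x \<in> U" for x v
    using that by (simp add: frechet_derivative_at[OF *, symmetric])
  have "Ck_on k U (\<lambda>x. frechet_derivative (\<lambda>x. f x * g x) (at x) v)" for v
  proof (rule Ck_on_cong[OF assms(1) sym])
    show "Ck_on k U (\<lambda>x. f x * frechet_derivative g (at x) v
        + frechet_derivative f (at x) v * g x)"
      by (intro Ck_on_add[OF assms(1)] Suc.IH)
        (use Suc.prems in \<open>simp_all add: Ck_on_Suc_imp_Ck_on del: Ck_on.simps, simp_all\<close>)
  qed (rule deriv)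
  then show ?case using differentiableI[OF *] by simp
qed

lemma Ck_on_sum:
  assumes "open U" "\<And>i. i \<in> B \<Longrightarrow> Ck_on k U (f i)"
  shows "Ck_on k U (\<lambda>x. \<Sum>i\<in>B. f i x)"
  using assms(2)
  by (induction B rule: infinite_finite_induct) (auto intro: Ck_on_add[OF assms(1)] Ck_on_const)

text \<open>Smoothness of a function built from a section is only visible in local trivializations; this
  passes from an open cover to the whole manifold.\<close>

lemma Ck_on_Union:
  assumes "\<And>U. U \<in> C \<Longrightarrow> open U" "\<And>U. U \<in> C \<Longrightarrow> Ck_on k U f"
  shows "Ck_on k (\<Union>C) f"
  using assms(2)
proof (induction k arbitrary: f)
  case 0
  show ?case
    unfolding Ck_on.simps
  proof (rule continuous_on_open_Union)
    show "continuous_on U f" if "U \<in> C" for U using 0[OF that] by simp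
  qed (rule assms(1))
next
  case (Suc k)
  have "Ck_on k (\<Union>C) (\<lambda>x. frechet_derivative f (at x) v)" for v
    by (rule Suc.IH) (use Suc.prems in simp)
  then show ?case using Suc.prems by auto
qed

lemma smooth_on_mult:
  fixes f g :: "'m::real_normed_vector \<Rightarrow> real"
  shows "open U \<Longrightarrow> smooth_on U f \<Longrightarrow> smooth_on U g \<Longrightarrow> smooth_on U (\<lambda>x. f x * g x)"
  by (simp add: smooth_on_def Ck_on_mult)

lemma smooth_on_bounded_linear: "bounded_linear f \<Longrightarrow> smooth_on U f"
  by (simp add: smooth_on_def Ck_on_bounded_linear)

lemma smooth_on_subset: "smooth_on U f \<Longrightarrow> W \<subseteq> U \<Longrightarrow> smooth_on W f"
proof -
  have "Ck_on k U f \<Longrightarrow> W \<subseteq> U \<Longrightarrow> Ck_on k W f" for k and f :: "'a \<Rightarrow> 'b"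
  proof (induction k arbitrary: f)
    case (Suc k)
    then show ?case by (metis Ck_on.simps(2) subset_iff)
  qed (simp add: continuous_on_subset)
  then show "smooth_on U f \<Longrightarrow> W \<subseteq> U \<Longrightarrow> smooth_on W f"
    by (auto simp: smooth_on_def)
qed

lemma smooth_on_UNIV_differentiable: "smooth_on UNIV f \<Longrightarrow> f differentiable (at x)"
  unfolding smooth_on_def by (metis Ck_on.simps(2) UNIV_I)

lemma frechet_derivative_bounded_linear:
  "bounded_linear f \<Longrightarrow> frechet_derivative f (at x) = f"
  by (metis bounded_linear_imp_has_derivative frechet_derivative_at)


section \<open>Abelian ideals of reductive Lie algebras\<close>

lemma lie_algebra_skew:
  assumes "lie_algebra br"
  shows "br x y = - br y x"
proof -
  have bl: "bilinear br" and alt: "br z z = 0" for z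
    using assms by (auto simp: lie_algebra_def)
  have "br (x + y) (x + y) = br x x + br x y + (br y x + br y y)"
    by (simp add: bilinear_ladd[OF bl] bilinear_radd[OF bl])
  then show ?thesis by (simp add: alt eq_neg_iff_add_eq_0)
qed

text \<open>The projection of an abelian ideal to a simple summand has trivial bracket with that summand,
  because the bracket lands in the intersection of the two, which is \<open>0\<close>.  As simple Lie algebras have
  trivial centre, the ideal lies in the abelian factor.\<close>

lemma abelian_ideal_of_reductive_central:
  assumes lie: "lie_algebra br" and red: "reductive br"
    and I: "lie_ideal br UNIV I" and ab: "abelian_on br I" and x: "x \<in> I"
  shows "br x y = 0"
proof -
  have bl: "bilinear br" using lie by (auto simp: lie_algebra_def)
  note skew = lie_algebra_skew[OF lie]
  obtain s z where sz: "\<And>x y. x \<in> s \<Longrightarrow> y \<in> z \<Longrightarrow> br x y = 0"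
    and bij: "bij_betw (\<lambda>(x, y). x + y) (s \<times> z) UNIV"
    and ss: "semisimple_on br s" and zab: "abelian_on br z"
    using red by (auto simp: reductive_def)
  obtain n :: nat and S where S: "(\<forall>i<n. simple_on br (S i)) \<and>
     (\<forall>i<n. \<forall>j<n. i \<noteq> j \<longrightarrow> (\<forall>x\<in>S i. \<forall>y\<in>S j. br x y = 0)) \<and>
     bij_betw (\<lambda>c. \<Sum>i<n. c i) (Pi\<^sub>E {..<n} S) s"
    using ss[unfolded semisimple_on_def] by (elim exE)
  have simple: "simple_on br (S i)" if "i < n" for i using S that by simp
  have comm: "br x y = 0" if "i < n" "j < n" "i \<noteq> j" "x \<in> S i" "y \<in> S j" for i j x y
    using S that by simp
  have bijS: "bij_betw (\<lambda>c. \<Sum>i<n. c i) (Pi\<^sub>E {..<n} S) s"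
    using S by simp
  have subS: "subspace (S i)" and brS: "\<And>x y. x \<in> S i \<Longrightarrow> y \<in> S i \<Longrightarrow> br x y \<in> S i"
    and nab: "\<not> abelian_on br (S i)"
    and ideals: "\<And>K. lie_ideal br (S i) K \<Longrightarrow> K = {0} \<or> K = S i" if "i < n" for i
    using simple[OF that] by (auto simp: simple_on_def lie_subalgebra_def)
  have decomp: "\<exists>a b. a \<in> s \<and> b \<in> z \<and> w = a + b" for w
  proof -
    have "w \<in> (\<lambda>(x, y). x + y) ` (s \<times> z)" using bij by (simp add: bij_betw_def)
    then show ?thesis by auto
  qed
  have S_s: "S i \<subseteq> s" if i: "i < n" for i
  proof
    fix y assume y: "y \<in> S i"
    define c where "c = (\<lambda>j\<in>{..<n}. if j = i then y else 0)"
    have "c \<in> Pi\<^sub>E {..<n} S" using y subS by (auto simp: c_def subspace_0)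
    then have "(\<Sum>j<n. c j) \<in> s" using bijS by (auto simp: bij_betw_def)
    also have "(\<Sum>j<n. c j) = (\<Sum>j<n. if j = i then y else 0)"
      by (intro sum.cong) (auto simp: c_def)
    finally show "y \<in> s" using i by simp
  qed
  obtain a b where ab': "a \<in> s" "b \<in> z" "x = a + b" using decomp by blast
  obtain c where c: "c \<in> Pi\<^sub>E {..<n} S" "a = (\<Sum>i<n. c i)"
    using ab'(1) bijS by (auto simp: bij_betw_def)
  have "c i = 0" if i: "i < n" for i
  proof -
    have ci: "c i \<in> S i" using c i by auto
    \<comment> \<open>The ideal \<open>I\<close> cannot contain the simple summand, so it meets it in \<open>0\<close>.\<close>
    have "lie_ideal br (S i) (I \<inter> S i)"
      using I brS[OF i] subS[OF i] by (auto simp: lie_ideal_def intro: subspace_inter)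
    then have "I \<inter> S i = {0} \<or> I \<inter> S i = S i" by (rule ideals[OF i])
    moreover have "I \<inter> S i \<noteq> S i" using ab nab[OF i] unfolding abelian_on_def by blast
    ultimately have IS: "I \<inter> S i = {0}" by blast
    have c0: "br y (c i) = 0" if y: "y \<in> S i" for y
    proof -
      have "br y x = br y a + br y b" using ab' by (simp add: bilinear_radd[OF bl])
      also have "br y b = 0" using S_s[OF i] y ab' sz by blast
      also have "br y a = (\<Sum>j<n. br y (c j))"
        unfolding c using linear_sum[of "br y"] bl by (auto simp: bilinear_def)
      also have "\<dots> = (\<Sum>j<n. if j = i then br y (c i) else 0)"
        using comm[OF i _ _ y] c by (intro sum.cong) auto
      finally have "br y x = br y (c i)" using i by simp
      moreover have "br y x \<in> I" using I x by (auto simp: lie_ideal_def)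
      ultimately show ?thesis using brS[OF i y ci] IS by auto
    qed
    \<comment> \<open>Hence the component lies in the centre of the simple summand, which is an ideal.\<close>
    define K where "K = {w \<in> S i. \<forall>y\<in>S i. br y w = 0}"
    have "subspace K"
      using subS[OF i] bl
      by (auto simp: K_def subspace_def bilinear_radd bilinear_rmul bilinear_rzero)
    then have "lie_ideal br (S i) K"
      using subspace_0[OF subS[OF i]] bl by (auto simp: lie_ideal_def K_def bilinear_rzero)
    then have "K = {0} \<or> K = S i" by (rule ideals[OF i])
    moreover have "K \<noteq> S i" using nab[OF i] by (auto simp: abelian_on_def K_def)
    moreover have "c i \<in> K" using ci c0 by (auto simp: K_def)
    ultimately show ?thesis by auto
  qed
  then have xz: "x \<in> z" using ab' c by simp
  obtain a' b' where y: "a' \<in> s" "b' \<in> z" "y = a' + b'" using decomp by blast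
  have "br x y = br x a' + br x b'" using y by (simp add: bilinear_radd[OF bl])
  moreover have "br x a' = 0" using skew[of x a'] sz[OF y(1) xz] by simp
  moreover have "br x b' = 0" using zab xz y by (auto simp: abelian_on_def)
  ultimately show ?thesis by simp
qed


section \<open>Linear algebra on the fibres\<close>

lemma linear_map_on_sum:
  assumes "linear_map_on V f" "subspace V" "\<And>i. i \<in> B \<Longrightarrow> a i \<in> V"
  shows "f (\<Sum>i\<in>B. c i *\<^sub>R a i) = (\<Sum>i\<in>B. c i *\<^sub>R f (a i))"
proof -
  have f0: "f 0 = 0"
    using assms(1) subspace_0[OF assms(2)] unfolding linear_map_on_def
    by (metis scaleR_zero_left)
  show ?thesis
    using assms(3)
  proof (induction B rule: infinite_finite_induct)
    case (insert i B)
    have "(\<Sum>i\<in>B. c i *\<^sub>R a i) \<in> V" "c i *\<^sub>R a i \<in> V"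
      using insert.prems assms(2) by (auto intro!: subspace_sum subspace_scale)
    then show ?case
      using insert assms(1) by (auto simp: linear_map_on_def)
  qed (auto simp: f0)
qed

lemma linear_map_on_0:
  assumes "linear_map_on V f" "subspace V" shows "f 0 = 0"
  using linear_map_on_sum[OF assms, of "{}"] by simp

lemma subspace_linear_map_on_image:
  assumes f: "linear_map_on V f" and V: "subspace V"
  shows "subspace (f ` V)"
proof (rule subspaceI)
  show "0 \<in> f ` V" using linear_map_on_0[OF f V] subspace_0[OF V] by (metis image_eqI)
  show "x + y \<in> f ` V" if "x \<in> f ` V" "y \<in> f ` V" for x y
    using that f V unfolding linear_map_on_def by (smt (verit) image_iff subspace_add)
  show "c *\<^sub>R x \<in> f ` V" if "x \<in> f ` V" for c x
    using that f V unfolding linear_map_on_def by (smt (verit) image_iff subspace_scale)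
qed

text \<open>Maps on fibres are linear only on a subspace; extending them to the whole space makes the
  theory of total linear maps applicable.\<close>

lemma linear_map_on_extend:
  assumes "linear_map_on (span E) f" "independent E"
  obtains g where "linear g" "\<And>a. a \<in> span E \<Longrightarrow> g a = f a"
proof -
  obtain g where g: "linear g" "\<forall>a\<in>E. g a = f a"
    using linear_independent_extend[OF assms(2)] by blast
  have "span E \<subseteq> {a \<in> span E. g a = f a}"
  proof (rule span_minimal)
    show "E \<subseteq> {a \<in> span E. g a = f a}" using g(2) by (auto intro: span_base)
    show "subspace {a \<in> span E. g a = f a}"
      using assms(1) linear_map_on_0[OF assms(1)] g(1)
      by (auto simp: subspace_def linear_map_on_def linear_0 linear_add linear_scale
          span_zero span_add span_scale)
  qed
  then show thesis using that[OF g(1)] by blast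
qed

lemma linear_map_on_diff_sum:
  assumes f: "linear_map_on V f" and V: "subspace V"
    and XY: "\<And>i. i \<in> B \<Longrightarrow> X i \<in> V" "\<And>i. i \<in> B \<Longrightarrow> Y i \<in> V"
  shows "f (\<Sum>i\<in>B. a i *\<^sub>R Y i - b i *\<^sub>R X i) = (\<Sum>i\<in>B. a i *\<^sub>R f (Y i) - b i *\<^sub>R f (X i))"
proof -
  let ?p = "\<Sum>i\<in>B. a i *\<^sub>R Y i" and ?q = "\<Sum>i\<in>B. (- b i) *\<^sub>R X i"
  have "?p \<in> V" "?q \<in> V"
    using XY V by (auto intro!: subspace_sum subspace_scale subspace_neg)
  then have "f (?p + ?q) = f ?p + f ?q"
    using f unfolding linear_map_on_def by blast
  also have "\<dots> = (\<Sum>i\<in>B. a i *\<^sub>R f (Y i)) + (\<Sum>i\<in>B. (- b i) *\<^sub>R f (X i))"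
    by (intro arg_cong2[of _ _ _ _ "(+)"] linear_map_on_sum[OF f V] XY)
  finally show ?thesis by (simp add: sum_subtractf sum_negf)
qed

lemma trivialization_frame:
  assumes sub: "subspace V" and lin: "\<forall>i<r. linear_map_on V (\<lambda>a. \<phi> a i)"
    and bij: "bij_betw \<phi> V (coord_space r)"
    and e: "e = (\<lambda>j. inv_into V \<phi> (\<lambda>i. if i = j then 1 else 0))"
  shows "j < r \<Longrightarrow> e j \<in> V" "i < r \<Longrightarrow> j < r \<Longrightarrow> \<phi> (e j) i = (if i = j then 1 else 0)"
    "a \<in> V \<Longrightarrow> a = (\<Sum>j<r. \<phi> a j *\<^sub>R e j)"
proof -
  have u: "(\<lambda>i. if i = j then 1 else 0) \<in> coord_space r" if "j < r" for j
    using that by (auto simp: coord_space_def)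
  show eV: "e j \<in> V" if "j < r" for j
    using u[OF that] bij unfolding e by (metis bij_betw_def inv_into_into)
  show ee: "\<phi> (e j) i = (if i = j then 1 else 0)" if "i < r" "j < r" for i j
    using u[OF that(2)] bij unfolding e by (simp add: bij_betw_inv_into_right)
  show "a = (\<Sum>j<r. \<phi> a j *\<^sub>R e j)" if a: "a \<in> V" for a
  proof -
    have mem: "(\<Sum>j<r. \<phi> a j *\<^sub>R e j) \<in> V"
      using eV sub by (auto intro!: subspace_sum subspace_scale)
    have "\<phi> (\<Sum>j<r. \<phi> a j *\<^sub>R e j) i = \<phi> a i" for i
    proof (cases "i < r")
      case True
      have "\<phi> (\<Sum>j<r. \<phi> a j *\<^sub>R e j) i = (\<Sum>j<r. \<phi> a j *\<^sub>R \<phi> (e j) i)"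
        unfolding real_scaleR_def[symmetric]
        by (rule linear_map_on_sum[OF lin[rule_format, OF True] sub]) (use eV in auto)
      also have "\<dots> = (\<Sum>j<r. if i = j then \<phi> a j else 0)"
        using ee True by (intro sum.cong) auto
      finally show ?thesis using True by simp
    next
      case False
      have "\<phi> b \<in> coord_space r" if "b \<in> V" for b using bij that by (auto simp: bij_betw_def)
      then show ?thesis using False mem a by (auto simp: coord_space_def)
    qed
    then show ?thesis
      using bij mem a by (metis bij_betw_def inj_on_def ext)
  qed
qed

lemma trivialization_basis:
  assumes "subspace V" "\<forall>i<r. linear_map_on V (\<lambda>a. \<phi> a i)"
    "bij_betw \<phi> V (coord_space r)"
  obtains E where "finite E" "independent E" "span E = V" "card E = r"
proof -
  define e where "e = (\<lambda>j. inv_into V \<phi> (\<lambda>i. if i = j then 1 else 0))"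
  note fr = trivialization_frame[OF assms e_def]
  have inj: "inj_on e {..<r}"
    using fr(2) by (intro inj_onI) (metis lessThan_iff zero_neq_one)
  have ind: "independent (e ` {..<r})"
    unfolding independent_explicit_module
  proof (intro allI impI)
    fix T u v assume T: "finite T" "T \<subseteq> e ` {..<r}" "(\<Sum>v\<in>T. u v *\<^sub>R v) = 0" "v \<in> T"
    obtain i where i: "i < r" "v = e i" using T by auto
    have "0 = \<phi> (\<Sum>v\<in>T. u v *\<^sub>R v) i"
      using linear_map_on_0[OF assms(2)[rule_format, OF i(1)] assms(1)] T by simp
    also have "\<dots> = (\<Sum>v\<in>T. u v *\<^sub>R \<phi> v i)"
      using T fr(1) by (intro linear_map_on_sum[OF assms(2)[rule_format, OF i(1)] assms(1)]) auto
    also have "\<dots> = (\<Sum>w\<in>T. if w = v then u v else 0)"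
    proof (intro sum.cong refl)
      fix w assume w: "w \<in> T"
      then obtain j where "j < r" "w = e j" using T by auto
      then show "u w *\<^sub>R \<phi> w i = (if w = v then u v else 0)"
        using fr(2)[OF i(1), of j] fr(2)[OF i(1) i(1)] i by (cases "i = j") auto
    qed
    finally show "u v = 0" using T by simp
  qed
  have "span (e ` {..<r}) = V"
  proof
    show "span (e ` {..<r}) \<subseteq> V" using fr(1) assms(1) by (intro span_minimal) auto
    show "V \<subseteq> span (e ` {..<r})"
    proof
      fix a assume "a \<in> V"
      then have "a = (\<Sum>j<r. \<phi> a j *\<^sub>R e j)" by (rule fr(3))
      also have "\<dots> \<in> span (e ` {..<r})"
        by (intro span_sum span_scale span_base) auto
      finally show "a \<in> span (e ` {..<r})" .
    qed
  qed
  then show thesis using that[of "e ` {..<r}"] ind card_image[OF inj] by simp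
qed

text \<open>The map \<open>S\<close> takes values in the kernel of \<open>f\<close> and is injective on the image \<open>U\<close> of \<open>f\<close>, since
  its kernel is orthogonal to \<open>U\<close>.  So a linear section of \<open>f\<close> and \<open>S\<close> together embed \<open>U \<times> U\<close> into
  the domain of \<open>f\<close>.  In the application \<open>f\<close> is the anchor at the origin and \<open>S\<close> sends \<open>y\<close> to its
  Hamiltonian element.\<close>

lemma twice_dim_image_le:
  fixes f :: "'a::real_vector \<Rightarrow> 'g::euclidean_space" and S :: "'g \<Rightarrow> 'a"
  assumes E: "finite E" "independent E" and f: "linear_map_on (span E) f" and S: "linear S"
    and S_in: "\<And>y. S y \<in> span E" and fS: "\<And>y. f (S y) = 0"
    and S0: "\<And>y a. S y = 0 \<Longrightarrow> a \<in> span E \<Longrightarrow> f a \<bullet> y = 0"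
  shows "2 * dim (f ` span E) \<le> card E"
proof -
  obtain g where g: "linear g" "\<And>a. a \<in> span E \<Longrightarrow> g a = f a"
    using linear_map_on_extend[OF f E(2)] by blast
  define U where "U = f ` span E"
  have U_g: "U = g ` span E" using g by (auto simp: U_def)
  have subU: "subspace U" unfolding U_g by (intro linear_subspace_image g(1) subspace_span)
  obtain B where B: "B \<subseteq> U" "independent B" "U \<subseteq> span B" "card B = dim U"
    using basis_exists by blast
  then have spB: "span B = U" using subU by (simp add: span_subspace)
  \<comment> \<open>a linear section of the map onto its image\<close>
  have "\<forall>b\<in>B. \<exists>a. a \<in> span E \<and> g a = b" using B by (auto simp: U_g)
  then obtain l where l: "\<And>b. b \<in> B \<Longrightarrow> l b \<in> span E \<and> g (l b) = b" by metis
  obtain L where L: "linear L" "\<forall>b\<in>B. L b = l b"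
    using linear_independent_extend[OF B(2)] by blast
  have L_in: "L u \<in> span E" and gL: "g (L u) = u" if "u \<in> U" for u
  proof -
    have u: "u \<in> span B" using that spB by simp
    have "L u \<in> span E \<and> g (L u) = u"
      using u
    proof (induction rule: span_induct_alt)
      case base
      then show ?case using L g by (simp add: linear_0 span_zero)
    next
      case (step c x y)
      then show ?case using L g l[of x]
        by (auto simp: linear_add linear_scale span_add span_scale)
    qed
    then show "L u \<in> span E" "g (L u) = u" by auto
  qed
  define T where "T = (\<lambda>(u, v). L u + S v)"
  have linT: "linear T"
    unfolding T_def case_prod_unfold
    by (intro linear_compose_add linear_compose[OF linear_fst L(1), unfolded o_def]
        linear_compose[OF linear_snd S, unfolded o_def])
  have subUU: "subspace (U \<times> U)" using subU by (rule subspace_Times[OF _ subU])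
  have T0: "p = 0" if pU: "p \<in> U \<times> U" and Tp: "T p = 0" for p
  proof -
    obtain u v where p: "p = (u, v)" "u \<in> U" "v \<in> U" using pU by blast
    have z: "L u + S v = 0" using Tp p by (simp add: T_def)
    have "0 = g (L u + S v)" using g z by (simp add: linear_0)
    also have "\<dots> = u" using g S_in fS gL p by (simp add: linear_add)
    finally have u: "u = 0" by simp
    then have "S v = 0" using z L by (simp add: linear_0)
    moreover obtain a where "a \<in> span E" "v = f a" using p by (auto simp: U_def)
    ultimately have "v \<bullet> v = 0" using S0 by blast
    then show ?thesis using p u by (simp add: zero_prod_def)
  qed
  have injT: "inj_on T (U \<times> U)"
    using linear_injective_on_subspace_0[OF linT subUU] T0 by blast
  obtain C where C: "C \<subseteq> U \<times> U" "independent C" "U \<times> U \<subseteq> span C" "card C = dim (U \<times> U)"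
    using basis_exists by blast
  have spC: "span C = U \<times> U" using C subUU by (simp add: span_subspace)
  have "independent (T ` C)"
    using linear_independent_injective_image[OF linT C(2)] injT spC by simp
  moreover have "T ` C \<subseteq> span E"
    using C(1) L_in S_in by (auto simp: T_def intro: span_add)
  ultimately have "card (T ` C) \<le> card E"
    using independent_span_bound[OF E(1)] by blast
  moreover have "card (T ` C) = card C" using injT C(1) by (meson card_image inj_on_subset)
  moreover have "dim (U \<times> U) = 2 * dim U" using dim_Times[OF subU subU] by simp
  ultimately show ?thesis using C(4) U_def by simp
qed

lemma dim_injective_image:
  fixes f :: "'a::real_vector \<Rightarrow> 'g::euclidean_space"
  assumes E: "independent E" and f: "linear_map_on (span E) f" and inj: "inj_on f (span E)"
  shows "dim (f ` span E) = card E"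
proof -
  obtain g where g: "linear g" "\<And>a. a \<in> span E \<Longrightarrow> g a = f a"
    using linear_map_on_extend[OF f E] by blast
  have injg: "inj_on g (span E)" using inj g(2) by (simp add: inj_on_def)
  have "independent (g ` E)" by (rule linear_independent_injective_image[OF g(1) E injg])
  moreover have "f ` span E = span (g ` E)"
    using g(2) by (simp add: linear_span_image[OF g(1)])
  moreover have "card (g ` E) = card E"
    using injg span_superset by (metis card_image inj_on_subset)
  ultimately show ?thesis by (simp add: dim_eq_card_independent)
qed


section \<open>Sections of a Lie algebroid and their anchors\<close>

lemma trivialization_at:
  assumes "smooth_vector_bundle A"
  obtains U \<phi> where "(U, \<phi>) \<in> trivs A" "x \<in> U"
    "\<forall>i<rk A. linear_map_on (fibre A x) (\<lambda>a. \<phi> x a i)"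
    "bij_betw (\<phi> x) (fibre A x) (coord_space (rk A))"
proof -
  have cover: "(\<Union>(U, \<phi>)\<in>trivs A. U) = UNIV" and
    triv: "\<forall>(U, \<phi>)\<in>trivs A. open U \<and>
        (\<forall>x\<in>U. (\<forall>i<rk A. linear_map_on (fibre A x) (\<lambda>a. \<phi> x a i)) \<and>
               bij_betw (\<phi> x) (fibre A x) (coord_space (rk A)))"
    using assms unfolding smooth_vector_bundle_def by simp_all
  have "x \<in> (\<Union>(U, \<phi>)\<in>trivs A. U)" unfolding cover by simp
  then obtain U \<phi> where "(U, \<phi>) \<in> trivs A" "x \<in> U" by auto
  then show thesis using triv that by fastforce
qed

lemma open_trivialization:
  "smooth_vector_bundle A \<Longrightarrow> (U, \<phi>) \<in> trivs A \<Longrightarrow> open U"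
  unfolding smooth_vector_bundle_def by auto

lemma smooth_section_scale:
  assumes A: "smooth_vector_bundle A" and s: "smooth_section A s" and f: "smooth_on UNIV f"
  shows "smooth_section A (\<lambda>x. f x *\<^sub>R s x)"
proof -
  have sV: "s x \<in> fibre A x" for x using s by (simp add: smooth_section_def)
  have sub: "subspace (fibre A x)" for x using A by (simp add: smooth_vector_bundle_def)
  have 1: "f x *\<^sub>R s x \<in> fibre A x" for x by (rule subspace_scale[OF sub sV])
  have 2: "smooth_on U (\<lambda>x. \<phi> x (f x *\<^sub>R s x) i)" if U: "(U, \<phi>) \<in> trivs A" and i: "i < rk A" for U \<phi> i
  proof -
    have lin: "linear_map_on (fibre A x) (\<lambda>a. \<phi> x a i)" if "x \<in> U" for x
      using A U i that unfolding smooth_vector_bundle_def by fast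
    have eq: "f x * \<phi> x (s x) i = \<phi> x (f x *\<^sub>R s x) i" if "x \<in> U" for x
      using lin[OF that] sV by (simp add: linear_map_on_def)
    have "smooth_on U (\<lambda>x. \<phi> x (s x) i)"
      using s U i unfolding smooth_section_def by fast
    then have "smooth_on U (\<lambda>x. f x * \<phi> x (s x) i)"
      using smooth_on_subset[OF f] open_trivialization[OF A U] by (intro smooth_on_mult) auto
    then show ?thesis
      using Ck_on_cong[OF open_trivialization[OF A U] eq] by (simp add: smooth_on_def)
  qed
  show ?thesis
    unfolding smooth_section_def using 1 2 by auto
qed

lemma smooth_section_add:
  assumes A: "smooth_vector_bundle A" and s: "smooth_section A s" and t: "smooth_section A t"
  shows "smooth_section A (\<lambda>x. s x + t x)"
proof -
  have V: "s x \<in> fibre A x" "t x \<in> fibre A x" for x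
    using s t by (simp_all add: smooth_section_def)
  have sub: "subspace (fibre A x)" for x using A by (simp add: smooth_vector_bundle_def)
  have 1: "s x + t x \<in> fibre A x" for x by (rule subspace_add[OF sub V])
  have 2: "smooth_on U (\<lambda>x. \<phi> x (s x + t x) i)" if U: "(U, \<phi>) \<in> trivs A" and i: "i < rk A" for U \<phi> i
  proof -
    have lin: "linear_map_on (fibre A x) (\<lambda>a. \<phi> x a i)" if "x \<in> U" for x
      using A U i that unfolding smooth_vector_bundle_def by fast
    have eq: "\<phi> x (s x) i + \<phi> x (t x) i = \<phi> x (s x + t x) i" if "x \<in> U" for x
      using lin[OF that] V by (simp add: linear_map_on_def)
    have "smooth_on U (\<lambda>x. \<phi> x (s x) i)" "smooth_on U (\<lambda>x. \<phi> x (t x) i)"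
      using s t U i unfolding smooth_section_def by fast+
    then have "smooth_on U (\<lambda>x. \<phi> x (s x) i + \<phi> x (t x) i)"
      by (simp add: smooth_on_def Ck_on_add[OF open_trivialization[OF A U]])
    then show ?thesis
      using Ck_on_cong[OF open_trivialization[OF A U] eq] by (simp add: smooth_on_def)
  qed
  show ?thesis
    unfolding smooth_section_def using 1 2 by auto
qed

text \<open>Locally the section is a combination of frame vectors with smooth coefficients, and the
  anchors of the frame vectors are smooth by definition.\<close>

lemma smooth_anchor_section:
  fixes A :: "('m::real_normed_vector, 'a::real_vector) lie_algebroid" and L :: "'m \<Rightarrow> real"
  assumes A: "smooth_vector_bundle A" and an: "smooth_anchor A" and s: "smooth_section A s"
    and L: "bounded_linear L"
  shows "smooth_on UNIV (\<lambda>x. L (anchor A x (s x)))"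
  unfolding smooth_on_def
proof
  fix k
  have cover: "\<Union>(fst ` trivs A) = UNIV"
    using A by (auto simp: smooth_vector_bundle_def case_prod_unfold)
  have "Ck_on k U (\<lambda>x. L (anchor A x (s x)))" if U: "(U, \<phi>) \<in> trivs A" for U \<phi>
  proof (rule Ck_on_cong)
    define e where "e = (\<lambda>j x. inv_into (fibre A x) (\<phi> x) (\<lambda>i. if i = j then 1 else 0))"
    show oU: "open U" by (rule open_trivialization[OF A U])
    show "Ck_on k U (\<lambda>x. \<Sum>j<rk A. \<phi> x (s x) j * L (anchor A x (e j x)))"
    proof (intro Ck_on_sum oU Ck_on_mult)
      fix j assume j: "j \<in> {..<rk A}"
      show "Ck_on k U (\<lambda>x. \<phi> x (s x) j)"
        using s U j unfolding smooth_section_def smooth_on_def by fast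
      have "(\<lambda>i. if i = j then 1 else 0) \<in> coord_space (rk A)"
        using j by (auto simp: coord_space_def)
      then have "Ck_on k U (\<lambda>x. anchor A x (e j x))"
        using an U unfolding smooth_anchor_def smooth_on_def e_def by fast
      then show "Ck_on k U (\<lambda>x. L (anchor A x (e j x)))"
        by (rule Ck_on_compose_bounded_linear[OF L oU])
    qed
    fix x assume x: "x \<in> U"
    have sub: "subspace (fibre A x)" using A by (simp add: smooth_vector_bundle_def)
    have lin: "\<forall>i<rk A. linear_map_on (fibre A x) (\<lambda>a. \<phi> x a i)"
      and bij: "bij_betw (\<phi> x) (fibre A x) (coord_space (rk A))"
      using A U x unfolding smooth_vector_bundle_def by fast+
    note fr = trivialization_frame[OF sub lin bij, of "\<lambda>j. e j x"]
    have e: "(\<lambda>j. e j x) = (\<lambda>j. inv_into (fibre A x) (\<phi> x) (\<lambda>i. if i = j then 1 else 0))"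
      by (simp add: e_def)
    have sx: "s x = (\<Sum>j<rk A. \<phi> x (s x) j *\<^sub>R e j x)"
      using s by (intro fr(3) e) (simp add: smooth_section_def)
    have "anchor A x (\<Sum>j<rk A. \<phi> x (s x) j *\<^sub>R e j x)
        = (\<Sum>j<rk A. \<phi> x (s x) j *\<^sub>R anchor A x (e j x))"
      using an fr(1)[OF e] by (intro linear_map_on_sum[OF _ sub]) (auto simp: smooth_anchor_def)
    then show "(\<Sum>j<rk A. \<phi> x (s x) j * L (anchor A x (e j x))) = L (anchor A x (s x))"
      using sx L by (simp add: linear_sum linear_scale bounded_linear.linear)
  qed
  then have "Ck_on k U (\<lambda>x. L (anchor A x (s x)))" if "U \<in> fst ` trivs A" for U
    using that by auto
  then have "Ck_on k (\<Union>(fst ` trivs A)) (\<lambda>x. L (anchor A x (s x)))"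
    using open_trivialization[OF A] by (intro Ck_on_Union) auto
  then show "Ck_on k UNIV (\<lambda>x. L (anchor A x (s x)))" by (simp add: cover)
qed

text \<open>That the anchor respects brackets follows from the Jacobi identity and the Leibniz rule: expand
  the Jacobi identity for \<open>s\<close>, \<open>t\<close> and \<open>L u\<close>.  The Jacobi identity for \<open>s\<close>, \<open>t\<close>, \<open>u\<close> cancels the terms
  with a factor \<open>L\<close>, and the mixed terms cancel in pairs; what remains is the difference of the two
  sides times \<open>u\<close>.\<close>

lemma anchor_bracket:
  fixes A :: "('m::real_normed_vector, 'a::real_vector) lie_algebroid" and L :: "'m \<Rightarrow> real"
  assumes A: "lie_algebroid A" and s: "smooth_section A s" and t: "smooth_section A t"
    and u: "smooth_section A u" "u x \<noteq> 0" and L: "bounded_linear L"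
  shows "L (anchor A x (bracket A s t x)) =
      frechet_derivative (\<lambda>y. L (anchor A y (t y))) (at x) (anchor A x (s x)) -
      frechet_derivative (\<lambda>y. L (anchor A y (s y))) (at x) (anchor A x (t x))"
proof -
  define d where "d = (\<lambda>v y. L (anchor A y (v y)))"
  have dv: "L (anchor A y (v y)) = d v y" for v y by (simp add: d_def)
  have vb: "smooth_vector_bundle A" and an: "smooth_anchor A"
    using A unfolding lie_algebroid_def by simp_all
  have br: "smooth_section A (bracket A v w)" if "smooth_section A v" "smooth_section A w" for v w
    using A that unfolding lie_algebroid_def by simp
  have addl: "bracket A (\<lambda>x. v x + v' x) w = (\<lambda>x. bracket A v w x + bracket A v' w x)"
    and addr: "bracket A w (\<lambda>x. v x + v' x) = (\<lambda>x. bracket A w v x + bracket A w v' x)"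
    if "smooth_section A v" "smooth_section A v'" "smooth_section A w" for v v' w
    using A that unfolding lie_algebroid_def by simp_all
  have scaler: "bracket A v (\<lambda>x. c *\<^sub>R w x) = (\<lambda>x. c *\<^sub>R bracket A v w x)"
    if "smooth_section A v" "smooth_section A w" for v w c
    using A that unfolding lie_algebroid_def by simp
  have alt: "bracket A v v = (\<lambda>x. 0)" if "smooth_section A v" for v
    using A that unfolding lie_algebroid_def by simp
  have jac: "bracket A v (bracket A w z) y + bracket A w (bracket A z v) y
              + bracket A z (bracket A v w) y = 0"
    if "smooth_section A v" "smooth_section A w" "smooth_section A z" for v w z y
    using A that unfolding lie_algebroid_def by simp
  have leib: "bracket A v (\<lambda>y. f y *\<^sub>R w y) =
      (\<lambda>y. f y *\<^sub>R bracket A v w y + frechet_derivative f (at y) (anchor A y (v y)) *\<^sub>R w y)"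
    if "smooth_section A v" "smooth_section A w" "smooth_on UNIV f" for v w and f :: "'m \<Rightarrow> real"
    using A that unfolding lie_algebroid_def by (intro ext) simp
  have skew: "bracket A v w = (\<lambda>x. - bracket A w v x)"
    if v: "smooth_section A v" and w: "smooth_section A w" for v w
  proof
    fix y
    have vw: "smooth_section A (\<lambda>x. v x + w x)" by (rule smooth_section_add[OF vb v w])
    have "0 = bracket A v v y + bracket A v w y + (bracket A w v y + bracket A w w y)"
      using alt[OF vw] addl[OF v w vw] addr[OF v w v] addr[OF v w w] by metis
    then show "bracket A v w y = - bracket A w v y"
      by (simp add: alt[OF v] alt[OF w] eq_neg_iff_add_eq_0)
  qed
  have skew': "bracket A v (bracket A w z) y = - bracket A v (bracket A z w) y"
    if v: "smooth_section A v" and w: "smooth_section A w" and z: "smooth_section A z" for v w z y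
    using scaler[OF v br[OF z w], of "-1"] skew[OF w z] by simp
  have d: "smooth_on UNIV (d v)" if "smooth_section A v" for v
    unfolding d_def by (rule smooth_anchor_section[OF vb an that L])
  define Lu where "Lu = (\<lambda>y. L y *\<^sub>R u y)"
  have Lu: "smooth_section A Lu"
    unfolding Lu_def by (intro smooth_section_scale[OF vb u(1)] smooth_on_bounded_linear L)
  have bLu: "bracket A v Lu = (\<lambda>y. L y *\<^sub>R bracket A v u y + d v y *\<^sub>R u y)"
    if v: "smooth_section A v" for v
    unfolding Lu_def leib[OF v u(1) smooth_on_bounded_linear[OF L]]
    by (simp add: frechet_derivative_bounded_linear[OF L] d_def)
  have bbLu: "bracket A v (bracket A w Lu) x =
      L x *\<^sub>R bracket A v (bracket A w u) x + d v x *\<^sub>R bracket A w u x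
      + d w x *\<^sub>R bracket A v u x + frechet_derivative (d w) (at x) (anchor A x (v x)) *\<^sub>R u x"
    if v: "smooth_section A v" and w: "smooth_section A w" for v w
  proof -
    have "bracket A v (bracket A w Lu) =
        (\<lambda>y. bracket A v (\<lambda>y. L y *\<^sub>R bracket A w u y) y + bracket A v (\<lambda>y. d w y *\<^sub>R u y) y)"
      unfolding bLu[OF w]
      by (intro addr v smooth_section_scale[OF vb] br w u d smooth_on_bounded_linear L)
    then show ?thesis
      by (simp add: leib[OF v br[OF w u(1)] smooth_on_bounded_linear[OF L]] leib[OF v u(1) d[OF w]]
          frechet_derivative_bounded_linear[OF L] dv)
  qed
  let ?w = "bracket A s t"
  let ?Dt = "frechet_derivative (d t) (at x) (anchor A x (s x))"
  let ?Ds = "frechet_derivative (d s) (at x) (anchor A x (t x))"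
  have w: "smooth_section A ?w" by (rule br[OF s t])
  have J: "bracket A s (bracket A t v) x - bracket A t (bracket A s v) x - bracket A ?w v x = 0"
    if v: "smooth_section A v" for v
    using jac[OF s t v, of x] skew'[OF t v s, of x] skew[OF v w] by simp
  have "(?Dt - ?Ds - d ?w x) *\<^sub>R u x = 0"
  proof -
    have "0 = bracket A s (bracket A t Lu) x - bracket A t (bracket A s Lu) x - bracket A ?w Lu x"
      using J[OF Lu] by simp
    also have "\<dots> = L x *\<^sub>R (bracket A s (bracket A t u) x - bracket A t (bracket A s u) x
        - bracket A ?w u x) + (?Dt - ?Ds - d ?w x) *\<^sub>R u x"
      unfolding bbLu[OF s t] bbLu[OF t s] fun_cong[OF bLu[OF w]] by (simp add: algebra_simps)
    finally show ?thesis unfolding J[OF u(1)] by simp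
  qed
  then show ?thesis using u(2) by (simp add: d_def)
qed

text \<open>The source of global sections: when \<open>P\<close> is nondegenerate, the \<open>X i\<close> and \<open>Y i\<close> generate every
  fibre.\<close>

lemma bivector_decomposition:
  assumes "schouten_bracket A P Q T"
  obtains n :: nat and X Y where "\<forall>i<n. smooth_section A (X i) \<and> smooth_section A (Y i)"
    "\<forall>x. \<forall>\<alpha>\<in>dual_space (fibre A x). \<forall>\<beta>\<in>dual_space (fibre A x).
        P x \<alpha> \<beta> = (\<Sum>i<n. wedge2 (X i x) (Y i x) \<alpha> \<beta>)"
  using assms unfolding schouten_bracket_def
  apply (elim exE conjE)
  apply (rule that, assumption)
  apply (intro allI ballI)
  apply (drule spec, drule bspec, assumption, drule bspec, assumption, erule conjunct1)
  done

lemma dual_space_separates: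
  assumes A: "smooth_vector_bundle A" and ab: "a \<in> fibre A x" "b \<in> fibre A x"
    and eq: "\<And>\<beta>. \<beta> \<in> dual_space (fibre A x) \<Longrightarrow> \<beta> a = \<beta> b"
  shows "a = b"
proof -
  obtain U \<phi> where lin: "\<forall>i<rk A. linear_map_on (fibre A x) (\<lambda>a. \<phi> x a i)"
    and bij: "bij_betw (\<phi> x) (fibre A x) (coord_space (rk A))"
    using trivialization_at[OF A] by metis
  have sub: "subspace (fibre A x)" using A by (simp add: smooth_vector_bundle_def)
  have "\<phi> x a i = \<phi> x b i" for i
  proof (cases "i < rk A")
    case True
    then have "extend0 (fibre A x) (\<lambda>a. \<phi> x a i) \<in> dual_space (fibre A x)"
      using lin sub
      by (auto simp: dual_space_def extend0_def linear_map_on_def subspace_add subspace_scale)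
    from eq[OF this] show ?thesis using ab by (simp add: extend0_def)
  next
    case False
    have "\<phi> x a \<in> coord_space (rk A)" "\<phi> x b \<in> coord_space (rk A)"
      using bij ab by (auto simp: bij_betw_def)
    then show ?thesis using False by (simp add: coord_space_def)
  qed
  then show ?thesis using bij ab by (metis bij_betw_def inj_on_def ext)
qed

lemma sharp_decomposition:
  assumes A: "smooth_vector_bundle A" and \<alpha>: "\<alpha> \<in> dual_space (fibre A x)"
    and X: "\<And>i. i < n \<Longrightarrow> X i \<in> fibre A x" and Y: "\<And>i. i < n \<Longrightarrow> Y i \<in> fibre A x"
    and P: "\<And>\<beta>. \<beta> \<in> dual_space (fibre A x) \<Longrightarrow> P x \<alpha> \<beta> = (\<Sum>i<n. wedge2 (X i) (Y i) \<alpha> \<beta>)"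
  shows "sharp A P x \<alpha> = (\<Sum>i<n. \<alpha> (X i) *\<^sub>R Y i - \<alpha> (Y i) *\<^sub>R X i)"
  unfolding sharp_def
proof (rule the_equality)
  let ?a = "\<Sum>i<n. \<alpha> (X i) *\<^sub>R Y i - \<alpha> (Y i) *\<^sub>R X i"
  have sub: "subspace (fibre A x)" using A by (simp add: smooth_vector_bundle_def)
  have "\<beta> ?a = P x \<alpha> \<beta>" if "\<beta> \<in> dual_space (fibre A x)" for \<beta>
  proof -
    have "linear_map_on (fibre A x) \<beta>" using that by (simp add: dual_space_def)
    then show ?thesis
      using linear_map_on_diff_sum[of "fibre A x" \<beta> "{..<n}" X Y] sub X Y P[OF that]
      by (simp add: wedge2_def)
  qed
  moreover have "?a \<in> fibre A x"
    using X Y sub by (auto intro!: subspace_sum subspace_diff subspace_scale)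
  ultimately show *: "?a \<in> fibre A x \<and> (\<forall>\<beta>\<in>dual_space (fibre A x). \<beta> ?a = P x \<alpha> \<beta>)" by blast
  show "a = ?a" if "a \<in> fibre A x \<and> (\<forall>\<beta>\<in>dual_space (fibre A x). \<beta> a = P x \<alpha> \<beta>)" for a
    using that * by (intro dual_space_separates[OF A]) auto
qed


section \<open>Linear Poisson structures on the dual of a Lie algebra\<close>

lemma bounded_linear_evaluation: "bounded_linear (\<lambda>\<xi>::'g::real_normed_vector \<Rightarrow>\<^sub>L real. \<xi> x)"
  by (rule blinfun.bounded_linear_left)

lemma functional_separates:
  fixes x :: "'g::euclidean_space"
  assumes "\<And>\<eta> :: 'g \<Rightarrow>\<^sub>L real. \<eta> x = \<eta> y"
  shows "x = y"
proof -
  have "blinfun_inner_right (x - y) x = blinfun_inner_right (x - y) y" by (rule assms)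
  then have "(x - y) \<bullet> (x - y) = 0" by (simp add: inner_diff_right)
  then show ?thesis by simp
qed

lemma kks_bracket_linear:
  fixes br :: "'g::euclidean_space \<Rightarrow> 'g \<Rightarrow> 'g"
  shows "kks_bracket br (\<lambda>\<xi>. \<xi> x) (\<lambda>\<xi>. \<xi> y) \<xi> = \<xi> (br x y)"
proof -
  have "differential (\<lambda>\<xi>. \<xi> z) \<xi> = z" for z :: 'g
    unfolding differential_def frechet_derivative_bounded_linear[OF bounded_linear_evaluation]
    by (rule the_equality) (auto intro: functional_separates)
  then show ?thesis by (simp add: kks_bracket_def)
qed

text \<open>The function \<open>\<xi> \<mapsto> \<xi> [x, y]\<close> is linear, hence its own derivative at the origin; the right-hand
  side is the product rule, in which the factors annihilated by \<open>x\<close> drop out.\<close>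

lemma linear_bivector_derivative:
  fixes br :: "'g::euclidean_space \<Rightarrow> 'g \<Rightarrow> 'g" and X Y :: "nat \<Rightarrow> ('g \<Rightarrow>\<^sub>L real) \<Rightarrow> ('g \<Rightarrow>\<^sub>L real)"
    and \<eta> :: "'g \<Rightarrow>\<^sub>L real"
  assumes dX: "\<And>i z. i < n \<Longrightarrow> (\<lambda>\<xi>. X i \<xi> z) differentiable (at 0)"
    and dY: "\<And>i z. i < n \<Longrightarrow> (\<lambda>\<xi>. Y i \<xi> z) differentiable (at 0)"
    and pi: "\<And>(\<xi> :: 'g \<Rightarrow>\<^sub>L real) x y. blinfun_apply \<xi> (br x y) = (\<Sum>i<n. X i \<xi> x * Y i \<xi> y - Y i \<xi> x * X i \<xi> y)"
    and x: "\<And>i. i < n \<Longrightarrow> X i 0 x = 0" "\<And>i. i < n \<Longrightarrow> Y i 0 x = 0"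
  shows "\<eta> (br x y) = (\<Sum>i<n. frechet_derivative (\<lambda>\<xi>. X i \<xi> x) (at 0) \<eta> * Y i 0 y
                              - frechet_derivative (\<lambda>\<xi>. Y i \<xi> x) (at 0) \<eta> * X i 0 y)"
proof -
  let ?D = "\<lambda>(V :: ('g \<Rightarrow>\<^sub>L real) \<Rightarrow> ('g \<Rightarrow>\<^sub>L real)) z. frechet_derivative (\<lambda>\<xi>. V \<xi> z) (at 0)"
  have DX: "((\<lambda>\<xi>. X i \<xi> z) has_derivative ?D (X i) z) (at 0)"
    and DY: "((\<lambda>\<xi>. Y i \<xi> z) has_derivative ?D (Y i) z) (at 0)" if "i < n" for i z
    using dX dY that by (simp_all add: frechet_derivative_works)
  have 1: "((\<lambda>\<xi>. \<Sum>i<n. X i \<xi> x * Y i \<xi> y - Y i \<xi> x * X i \<xi> y) has_derivative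
     (\<lambda>\<eta>. \<Sum>i<n. (X i 0 x * ?D (Y i) y \<eta> + ?D (X i) x \<eta> * Y i 0 y)
           - (Y i 0 x * ?D (X i) y \<eta> + ?D (Y i) x \<eta> * X i 0 y))) (at 0)"
    by (intro has_derivative_sum has_derivative_diff has_derivative_mult DX DY) auto
  have 2: "((\<lambda>\<xi> :: 'g \<Rightarrow>\<^sub>L real. \<xi> (br x y)) has_derivative (\<lambda>\<eta>. \<eta> (br x y))) (at 0)"
    by (rule bounded_linear_imp_has_derivative[OF bounded_linear_evaluation])
  have "(\<lambda>\<eta>. blinfun_apply \<eta> (br x y)) =
     (\<lambda>\<eta>. \<Sum>i<n. (X i 0 x * ?D (Y i) y \<eta> + ?D (X i) x \<eta> * Y i 0 y)
           - (Y i 0 x * ?D (X i) y \<eta> + ?D (Y i) x \<eta> * X i 0 y))"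
    by (rule has_derivative_unique[OF 2 1[folded pi]])
  from fun_cong[OF this, of \<eta>] show ?thesis using x by simp
qed

text \<open>The last two hypotheses say that \<open>x\<close> annihilates, at the origin, the Lie brackets of \<open>V\<close> with all
  \<open>X i\<close> and \<open>Y i\<close>.  They turn the derivative of the bivector in the direction \<open>V 0\<close> into the derivative
  of \<open>V\<close> in the direction of the bivector contracted with \<open>y\<close>, and this direction is \<open>0\<close> because the
  bivector is linear and so vanishes at the origin.\<close>

lemma annihilator_invariant:
  fixes br :: "'g::euclidean_space \<Rightarrow> 'g \<Rightarrow> 'g" and X Y :: "nat \<Rightarrow> ('g \<Rightarrow>\<^sub>L real) \<Rightarrow> ('g \<Rightarrow>\<^sub>L real)"
    and V :: "('g \<Rightarrow>\<^sub>L real) \<Rightarrow> ('g \<Rightarrow>\<^sub>L real)"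
  assumes dX: "\<And>i z. i < n \<Longrightarrow> (\<lambda>\<xi>. X i \<xi> z) differentiable (at 0)"
    and dY: "\<And>i z. i < n \<Longrightarrow> (\<lambda>\<xi>. Y i \<xi> z) differentiable (at 0)"
    and pi: "\<And>(\<xi> :: 'g \<Rightarrow>\<^sub>L real) x y. blinfun_apply \<xi> (br x y) = (\<Sum>i<n. X i \<xi> x * Y i \<xi> y - Y i \<xi> x * X i \<xi> y)"
    and x: "\<And>i. i < n \<Longrightarrow> X i 0 x = 0" "\<And>i. i < n \<Longrightarrow> Y i 0 x = 0"
    and dV: "(\<lambda>\<xi>. V \<xi> x) differentiable (at 0)"
    and VX: "\<And>i. i < n \<Longrightarrow> frechet_derivative (\<lambda>\<xi>. X i \<xi> x) (at 0) (V 0)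
                         = frechet_derivative (\<lambda>\<xi>. V \<xi> x) (at 0) (X i 0)"
    and VY: "\<And>i. i < n \<Longrightarrow> frechet_derivative (\<lambda>\<xi>. Y i \<xi> x) (at 0) (V 0)
                         = frechet_derivative (\<lambda>\<xi>. V \<xi> x) (at 0) (Y i 0)"
  shows "V 0 (br x y) = 0"
proof -
  let ?D = "frechet_derivative (\<lambda>\<xi>. V \<xi> x) (at 0)"
  have lin: "linear ?D" using dV by (rule linear_frechet_derivative)
  have "V 0 (br x y) = (\<Sum>i<n. ?D (X i 0) * Y i 0 y - ?D (Y i 0) * X i 0 y)"
    using linear_bivector_derivative[OF dX dY pi x, where \<eta> = "V 0"] VX VY by simp
  also have "\<dots> = ?D (\<Sum>i<n. Y i 0 y *\<^sub>R X i 0 - X i 0 y *\<^sub>R Y i 0)"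
    using lin by (simp add: linear_sum linear_diff linear_scale mult.commute)
  also have "(\<Sum>i<n. Y i 0 y *\<^sub>R X i 0 - X i 0 y *\<^sub>R Y i 0) = 0"
    using pi[of 0 _ y]
    by (intro blinfun_eqI)
      (simp add: blinfun.sum_left blinfun.diff_left blinfun.scaleR_left mult.commute)
  finally show ?thesis using lin by (simp add: linear_0)
qed

text \<open>Moves functionals to the Euclidean space itself, where annihilators become orthogonal
  complements and dimensions can be counted.\<close>

definition riesz :: "('g::euclidean_space \<Rightarrow>\<^sub>L real) \<Rightarrow> 'g" where
  "riesz \<eta> = (\<Sum>b\<in>Basis. \<eta> b *\<^sub>R b)"

lemma riesz_inner: "riesz \<eta> \<bullet> x = \<eta> x"
proof -
  have "\<eta> x = \<eta> (\<Sum>b\<in>Basis. (x \<bullet> b) *\<^sub>R b)" by (simp add: euclidean_representation)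
  also have "\<dots> = riesz \<eta> \<bullet> x"
    by (simp add: riesz_def blinfun.sum_right blinfun.scaleR_right inner_sum_left inner_commute[of x] mult.commute)
  finally show ?thesis by simp
qed

lemma linear_riesz: "linear riesz"
  by (rule linearI)
    (simp_all add: riesz_def blinfun.add_left blinfun.scaleR_left scaleR_add_left sum.distrib scaleR_sum_right)

text \<open>The element \<open>ham \<xi> y\<close> is \<open>\<pi>\<^sub>A\<^sup>\<sharp>(\<rho>\<^sup>* y)\<close> at \<open>\<xi>\<close>, a lift through the anchor of the Hamiltonian vector
  field of the linear function \<open>y\<close>.  The last property is where nondegeneracy enters: \<open>\<pi>\<^sub>A\<^sup>\<sharp>\<close> is
  injective, so \<open>ham \<xi> y = 0\<close> means that the pulled back functional \<open>\<rho>\<^sup>* y\<close> is zero.\<close>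

lemma kks_desingularization_hamiltonian_sections:
  fixes br :: "'g::euclidean_space \<Rightarrow> 'g \<Rightarrow> 'g"
  assumes "desingularizable TYPE('a::real_vector) (kks_bracket br)"
  obtains A :: "('g \<Rightarrow>\<^sub>L real, 'a::real_vector) lie_algebroid" and n :: nat and X Y
    and ham :: "('g \<Rightarrow>\<^sub>L real) \<Rightarrow> 'g \<Rightarrow> 'a::real_vector"
  where "lie_algebroid A" "almost_injective A"
    "\<And>i. i < n \<Longrightarrow> smooth_section A (X i)" "\<And>i. i < n \<Longrightarrow> smooth_section A (Y i)"
    "\<And>\<xi> x y. blinfun_apply \<xi> (br x y) =
       (\<Sum>i<n. anchor A \<xi> (X i \<xi>) x * anchor A \<xi> (Y i \<xi>) y
             - anchor A \<xi> (Y i \<xi>) x * anchor A \<xi> (X i \<xi>) y)"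
    "\<And>\<xi> y. ham \<xi> y =
       (\<Sum>i<n. anchor A \<xi> (X i \<xi>) y *\<^sub>R Y i \<xi> - anchor A \<xi> (Y i \<xi>) y *\<^sub>R X i \<xi>)"
    "\<And>\<xi> y. ham \<xi> y \<in> fibre A \<xi>"
    "\<And>\<xi> y w. anchor A \<xi> (ham \<xi> y) w = blinfun_apply \<xi> (br y w)"
    "\<And>\<xi> y a. ham \<xi> y = 0 \<Longrightarrow> a \<in> fibre A \<xi> \<Longrightarrow> anchor A \<xi> a y = 0"
proof -
  obtain A :: "('g \<Rightarrow>\<^sub>L real, 'a) lie_algebroid" and P where
    AP: "symplectic_lie_algebroid A P \<and> almost_injective A \<and>
        (\<forall>f g. smooth_on UNIV f \<longrightarrow> smooth_on UNIV g \<longrightarrow>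
          (\<forall>x. kks_bracket br f g x =
            anchor_push A P x (frechet_derivative f (at x)) (frechet_derivative g (at x))))"
    using assms unfolding desingularizable_def by (elim exE)
  then have sympl: "symplectic_lie_algebroid A P" and inj: "almost_injective A" by simp_all
  have push: "kks_bracket br f g x =
      anchor_push A P x (frechet_derivative f (at x)) (frechet_derivative g (at x))"
    if "smooth_on UNIV f" "smooth_on UNIV g" for f g x
    using AP that by simp
  have A: "lie_algebroid A" and nd: "nondegenerate A P"
    and sch: "schouten_bracket A P P (\<lambda>x \<alpha> \<beta> \<gamma>. 0)"
    using sympl by (simp_all add: symplectic_lie_algebroid_def)
  have vb: "smooth_vector_bundle A" and an: "smooth_anchor A"
    using A unfolding lie_algebroid_def by simp_all
  have sub: "subspace (fibre A \<xi>)" for \<xi> using vb by (simp add: smooth_vector_bundle_def)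
  have lin: "linear_map_on (fibre A \<xi>) (anchor A \<xi>)" for \<xi>
    using an by (simp add: smooth_anchor_def)
  obtain n :: nat and X Y where
    XY: "\<forall>i<n. smooth_section A (X i) \<and> smooth_section A (Y i)" and
    PXY: "\<forall>\<xi>. \<forall>\<alpha>\<in>dual_space (fibre A \<xi>). \<forall>\<beta>\<in>dual_space (fibre A \<xi>).
          P \<xi> \<alpha> \<beta> = (\<Sum>i<n. wedge2 (X i \<xi>) (Y i \<xi>) \<alpha> \<beta>)"
    by (rule bivector_decomposition[OF sch])
  have P: "P \<xi> \<alpha> \<beta> = (\<Sum>i<n. wedge2 (X i \<xi>) (Y i \<xi>) \<alpha> \<beta>)"
    if "\<alpha> \<in> dual_space (fibre A \<xi>)" "\<beta> \<in> dual_space (fibre A \<xi>)" for \<xi> \<alpha> \<beta>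
    using PXY that by blast
  have X: "smooth_section A (X i)" and Y: "smooth_section A (Y i)" if "i < n" for i
    using XY that by auto
  have Xf: "X i \<xi> \<in> fibre A \<xi>" and Yf: "Y i \<xi> \<in> fibre A \<xi>" if "i < n" for i \<xi>
    using X[OF that] Y[OF that] by (simp_all add: smooth_section_def)
  define VX where "VX = (\<lambda>i \<xi>. anchor A \<xi> (X i \<xi>))"
  define VY where "VY = (\<lambda>i \<xi>. anchor A \<xi> (Y i \<xi>))"

  have sharp: "sharp A P \<xi> \<alpha> = (\<Sum>i<n. \<alpha> (X i \<xi>) *\<^sub>R Y i \<xi> - \<alpha> (Y i \<xi>) *\<^sub>R X i \<xi>)"
    if "\<alpha> \<in> dual_space (fibre A \<xi>)" for \<xi> \<alpha>
    using Xf Yf P[OF that] by (intro sharp_decomposition[OF vb that]) auto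
  define pull where "pull = (\<lambda>\<xi> y. extend0 (fibre A \<xi>) (\<lambda>a. anchor A \<xi> a y))"
  have pull: "pull \<xi> y \<in> dual_space (fibre A \<xi>)" for \<xi> y
    using lin[of \<xi>] sub[of \<xi>]
    by (auto simp: pull_def dual_space_def extend0_def linear_map_on_def blinfun.add_left
        blinfun.scaleR_left subspace_add subspace_scale)
  have pi: "\<xi> (br x y) = (\<Sum>i<n. VX i \<xi> x * VY i \<xi> y - VY i \<xi> x * VX i \<xi> y)"
    for \<xi> :: "'g \<Rightarrow>\<^sub>L real" and x y
  proof -
    note L = bounded_linear_evaluation
    have "\<xi> (br x y) = kks_bracket br (\<lambda>\<xi>. \<xi> x) (\<lambda>\<xi>. \<xi> y) \<xi>" by (simp add: kks_bracket_linear)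
    also have "\<dots> = P \<xi> (pull \<xi> x) (pull \<xi> y)"
      by (simp add: push smooth_on_bounded_linear L frechet_derivative_bounded_linear
          anchor_push_def pull_def o_def)
    also have "\<dots> = (\<Sum>i<n. wedge2 (X i \<xi>) (Y i \<xi>) (pull \<xi> x) (pull \<xi> y))"
      by (rule P[OF pull pull])
    also have "\<dots> = (\<Sum>i<n. VX i \<xi> x * VY i \<xi> y - VY i \<xi> x * VX i \<xi> y)"
      using Xf Yf by (intro sum.cong) (auto simp: wedge2_def pull_def extend0_def VX_def VY_def)
    finally show ?thesis .
  qed

  define ham where "ham = (\<lambda>\<xi> y. \<Sum>i<n. VX i \<xi> y *\<^sub>R Y i \<xi> - VY i \<xi> y *\<^sub>R X i \<xi>)"
  have ham_in: "ham \<xi> y \<in> fibre A \<xi>" for \<xi> y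
    unfolding ham_def using Xf Yf sub by (auto intro!: subspace_sum subspace_diff subspace_scale)
  have anchor_ham: "anchor A \<xi> (ham \<xi> y) w = \<xi> (br y w)" for \<xi> y w
  proof -
    have "anchor A \<xi> (ham \<xi> y) = (\<Sum>i<n. VX i \<xi> y *\<^sub>R VY i \<xi> - VY i \<xi> y *\<^sub>R VX i \<xi>)"
      unfolding ham_def VX_def VY_def using Xf Yf
      by (intro linear_map_on_diff_sum[OF lin sub]) auto
    then show ?thesis
      by (simp add: pi blinfun.sum_left blinfun.diff_left blinfun.scaleR_left)
  qed
  have ham0: "anchor A \<xi> a y = 0" if "ham \<xi> y = 0" "a \<in> fibre A \<xi>" for \<xi> y a
  proof -
    have zero: "(\<lambda>a. 0) \<in> dual_space (fibre A \<xi>)" by (simp add: dual_space_def linear_map_on_def)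
    have "sharp A P \<xi> (pull \<xi> y) = ham \<xi> y"
      unfolding sharp[OF pull] ham_def using Xf Yf
      by (intro sum.cong) (auto simp: pull_def extend0_def VX_def VY_def)
    also have "\<dots> = sharp A P \<xi> (\<lambda>a. 0)" using that(1) sharp[OF zero] by simp
    finally have "sharp A P \<xi> (pull \<xi> y) = sharp A P \<xi> (\<lambda>a. 0)" .
    moreover have "inj_on (sharp A P \<xi>) (dual_space (fibre A \<xi>))"
      using nd by (simp add: nondegenerate_def bij_betw_def)
    ultimately have "pull \<xi> y = (\<lambda>a. 0)" using pull zero by (metis inj_onD)
    from fun_cong[OF this, of a] show ?thesis using that(2) by (simp add: pull_def extend0_def)
  qed
  show thesis
    by (rule that[OF A inj X Y pi[unfolded VX_def VY_def] fun_cong[OF fun_cong[OF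
        ham_def[unfolded VX_def VY_def]]] ham_in anchor_ham ham0])
qed

theorem corollary39:
  fixes br :: "'g::euclidean_space \<Rightarrow> 'g \<Rightarrow> 'g"
  assumes "lie_algebra br" and "reductive br" and "\<not> abelian_on br UNIV"
  shows "\<not> desingularizable TYPE('a::real_vector) (kks_bracket br)"
proof
  assume "desingularizable TYPE('a) (kks_bracket br)"
  then show False
  proof (rule kks_desingularization_hamiltonian_sections)
    fix A :: "('g \<Rightarrow>\<^sub>L real, 'a) lie_algebroid" and n :: nat and X Y
        and ham :: "('g \<Rightarrow>\<^sub>L real) \<Rightarrow> 'g \<Rightarrow> 'a"
    assume A: "lie_algebroid A" and inj: "almost_injective A" and
      X: "\<And>i. i < n \<Longrightarrow> smooth_section A (X i)" and
      Y: "\<And>i. i < n \<Longrightarrow> smooth_section A (Y i)" and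
      pi: "\<And>\<xi> x y. blinfun_apply \<xi> (br x y) =
         (\<Sum>i<n. anchor A \<xi> (X i \<xi>) x * anchor A \<xi> (Y i \<xi>) y
               - anchor A \<xi> (Y i \<xi>) x * anchor A \<xi> (X i \<xi>) y)" and
      ham_def: "\<And>\<xi> y. ham \<xi> y =
         (\<Sum>i<n. anchor A \<xi> (X i \<xi>) y *\<^sub>R Y i \<xi> - anchor A \<xi> (Y i \<xi>) y *\<^sub>R X i \<xi>)" and
      ham_in: "\<And>\<xi> y. ham \<xi> y \<in> fibre A \<xi>" and
      anchor_ham: "\<And>\<xi> y w. anchor A \<xi> (ham \<xi> y) w = blinfun_apply \<xi> (br y w)" and
      ham0: "\<And>\<xi> y a. ham \<xi> y = 0 \<Longrightarrow> a \<in> fibre A \<xi> \<Longrightarrow> anchor A \<xi> a y = 0"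
    have vb: "smooth_vector_bundle A" and an: "smooth_anchor A"
      using A unfolding lie_algebroid_def by simp_all
    have sub: "subspace (fibre A \<xi>)" for \<xi> using vb by (simp add: smooth_vector_bundle_def)
    have lin: "linear_map_on (fibre A \<xi>) (anchor A \<xi>)" for \<xi>
      using an by (simp add: smooth_anchor_def)

    define I where "I = {x. \<forall>a\<in>fibre A 0. anchor A 0 a x = 0}"
    have I0: "anchor A 0 (X i 0) x = 0" "anchor A 0 (Y i 0) x = 0" if "x \<in> I" "i < n" for i x
      using that X Y by (simp_all add: I_def smooth_section_def)
    have diff: "(\<lambda>\<xi>. anchor A \<xi> (s \<xi>) z) differentiable (at 0)" if "smooth_section A s" for s z
      by (intro smooth_on_UNIV_differentiable smooth_anchor_section[OF vb an that]
          bounded_linear_evaluation)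
    have abI: "abelian_on br I"
      unfolding abelian_on_def
    proof (intro ballI, rule functional_separates)
      fix x y and \<eta> :: "'g \<Rightarrow>\<^sub>L real" assume xy: "x \<in> I" "y \<in> I"
      show "\<eta> (br x y) = \<eta> 0"
        using linear_bivector_derivative[OF diff[OF X] diff[OF Y] pi I0[OF xy(1)], where \<eta> = \<eta>]
          I0[OF xy(2)]
        by (simp add: blinfun.zero_right)
    qed

    \<comment> \<open>A section that does not vanish at the origin can itself serve as the third section in the
      proof that the anchor respects brackets.\<close>
    have inv: "anchor A 0 (s 0) (br x y) = 0" if x: "x \<in> I" and s: "smooth_section A s" for s x y
    proof (cases "s 0 = 0")
      case True
      then show ?thesis using linear_map_on_0[OF lin sub, of 0] by simp
    next
      case False
      have swap: "frechet_derivative (\<lambda>\<xi>. anchor A \<xi> (t \<xi>) x) (at 0) (anchor A 0 (s 0))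
          = frechet_derivative (\<lambda>\<xi>. anchor A \<xi> (s \<xi>) x) (at 0) (anchor A 0 (t 0))"
        if t: "smooth_section A t" for t
      proof -
        have "smooth_section A (bracket A s t)" using A s t by (simp add: lie_algebroid_def)
        then have "anchor A 0 (bracket A s t 0) x = 0"
          using x by (simp add: I_def smooth_section_def)
        then show ?thesis
          using anchor_bracket[OF A s t s, of 0 "\<lambda>\<xi>. \<xi> x"] False bounded_linear_evaluation by simp
      qed
      show ?thesis
        by (rule annihilator_invariant[OF diff[OF X] diff[OF Y] pi I0[OF x] diff[OF s]
              swap[OF X] swap[OF Y]])
    qed
    \<comment> \<open>The global sections generate the fibre, in the dual form that is needed here.\<close>
    have span: "anchor A 0 a z = 0"
      if a: "a \<in> fibre A 0" and z: "\<And>s. smooth_section A s \<Longrightarrow> anchor A 0 (s 0) z = 0" for a z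
    proof -
      have "ham 0 z = 0" unfolding ham_def using z X Y by simp
      then show ?thesis using a by (rule ham0)
    qed
    have "lie_ideal br UNIV I"
      unfolding lie_ideal_def
    proof (intro conjI ballI)
      show "subspace I"
        by (auto simp: subspace_def I_def blinfun.zero_right blinfun.add_right blinfun.scaleR_right)
      fix x y assume y: "y \<in> I"
      have "br x y = - br y x" by (rule lie_algebra_skew[OF assms(1)])
      moreover have "br y x \<in> I" using span inv[OF y] by (auto simp: I_def)
      ultimately show "br x y \<in> I" by (simp add: I_def blinfun.minus_right)
    qed simp
    then have central: "br x y = 0" if "x \<in> I" for x y
      using abelian_ideal_of_reductive_central[OF assms(1,2) _ abI that] by blast

    have basis: "\<exists>E. finite E \<and> independent E \<and> span E = fibre A \<xi> \<and> card E = rk A" for \<xi>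
      using trivialization_at[OF vb, of \<xi>] trivialization_basis[OF sub] by metis
    define f where "f = (\<lambda>\<xi> a. riesz (anchor A \<xi> a))"
    have f: "linear_map_on (fibre A \<xi>) (f \<xi>)" for \<xi>
      using lin[of \<xi>]
      by (simp add: linear_map_on_def f_def linear_add[OF linear_riesz] linear_scale[OF linear_riesz])
    define U where "U = f 0 ` fibre A 0"
    have "subspace U" unfolding U_def by (rule subspace_linear_map_on_image[OF f sub])
    have U: "x \<in> I" if "\<And>u. u \<in> U \<Longrightarrow> u \<bullet> x = 0" for x
      using that by (auto simp: I_def U_def f_def riesz_inner[symmetric])
    \<comment> \<open>The KKS bivector vanishes at the origin, so the anchor kills the Hamiltonian elements there.\<close>
    have "2 * dim U \<le> rk A"
    proof -
      obtain E where E: "finite E" "independent E" "span E = fibre A 0" "card E = rk A"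
        using basis by blast
      have "2 * dim (f 0 ` span E) \<le> card E"
      proof (rule twice_dim_image_le[OF E(1,2), of _ "ham 0"])
        show "linear_map_on (span E) (f 0)" using f E by simp
        show "linear (ham 0)"
          by (rule linearI) (simp_all add: ham_def blinfun.add_right blinfun.scaleR_right
              sum.distrib[symmetric] scaleR_sum_right algebra_simps)
        show "ham 0 y \<in> span E" for y using ham_in E by simp
        have "anchor A 0 (ham 0 y) = 0" for y
          by (rule blinfun_eqI) (simp add: anchor_ham)
        then show "f 0 (ham 0 y) = 0" for y
          by (simp add: f_def linear_0[OF linear_riesz])
        show "f 0 a \<bullet> y = 0" if "ham 0 y = 0" "a \<in> span E" for y a
          using that ham0 E by (simp add: f_def riesz_inner)
      qed
      then show ?thesis by (simp add: U_def E)
    qed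
    \<comment> \<open>The annihilator \<open>I\<close> of \<open>U\<close> also annihilates the image of the anchor at a point of injectivity.\<close>
    moreover have "rk A \<le> dim U"
    proof -
      obtain D where D: "closure D = UNIV" "\<forall>x\<in>D. inj_on (anchor A x) (fibre A x)"
        using inj by (auto simp: almost_injective_def)
      then have "D \<noteq> {}" by auto
      then obtain \<xi> where \<xi>: "inj_on (anchor A \<xi>) (fibre A \<xi>)" using D by blast
      obtain E where E: "finite E" "independent E" "span E = fibre A \<xi>" "card E = rk A"
        using basis by blast
      have "inj_on (f \<xi>) (fibre A \<xi>)"
      proof (rule inj_onI)
        fix a b assume ab: "a \<in> fibre A \<xi>" "b \<in> fibre A \<xi>" "f \<xi> a = f \<xi> b"
        then have "anchor A \<xi> a = anchor A \<xi> b"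
          by (intro blinfun_eqI) (metis f_def riesz_inner)
        then show "a = b" using \<xi> ab by (auto dest: inj_onD)
      qed
      then have "dim (f \<xi> ` fibre A \<xi>) = rk A"
        using dim_injective_image[of E "f \<xi>"] f E by simp
      moreover have "f \<xi> ` fibre A \<xi> \<subseteq> U"
      proof -
        have "f \<xi> a \<in> U\<^sup>\<bottom>\<^sup>\<bottom>" if a: "a \<in> fibre A \<xi>" for a
          unfolding orthogonal_comp_def[of "U\<^sup>\<bottom>"]
        proof (intro CollectI ballI)
          fix x assume "x \<in> U\<^sup>\<bottom>"
          then have x: "x \<in> I" by (intro U) (simp add: orthogonal_comp_def orthogonal_def)
          \<comment> \<open>Being central, \<open>x\<close> has vanishing Hamiltonian vector field.\<close>
          have "anchor A \<xi> (ham \<xi> x) = anchor A \<xi> 0"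
            using central[OF x] linear_map_on_0[OF lin sub]
            by (intro blinfun_eqI) (simp add: anchor_ham blinfun.zero_right)
          then have "ham \<xi> x = 0"
            using inj_onD[OF \<xi>] ham_in subspace_0[OF sub] by blast
          then have "anchor A \<xi> a x = 0" using a by (rule ham0)
          then show "orthogonal x (f \<xi> a)"
            by (simp add: orthogonal_def f_def inner_commute[of x] riesz_inner)
        qed
        then show ?thesis using orthogonal_comp_self[OF \<open>subspace U\<close>] by auto
      qed
      ultimately show ?thesis by (metis dim_subset)
    qed
    ultimately have "dim U = 0" by linarith
    then have "U \<subseteq> {0}" by simp
    then have "x \<in> I" for x by (intro U) auto
    then show False using abI assms(3) by (simp add: abelian_on_def)
  qed
qed

end
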